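(* Let $\pi=\mathcal{N}(m,\Sigma)$ on $\mathbb{R}^d$ with $m\in\mathbb{R}^d$ and $\Sigma\succ0$ with entries $\sigma_{ij}$, and let $\sigma^{ij}$ denote the $(i,j)$ entry of $\Sigma^{-1}$. Then $\min_{\mu\in\mathcal{C}_{\rm star}}\mathrm{KL}(\mu\|\pi)$ has a unique minimizer $\pi^\star(\mathrm{d}z)=\mathrm{p}^\star(\mathrm{d}z_1)\mathrm{q}^\star(\mathrm{d}z_{-1}\mid z_1)$ with $\mathrm{p}^\star=\mathcal{N}(m_1,\sigma_{11})$ and $\mathrm{q}^\star(\cdot\mid z_1)=\mathcal{N}(m^\star_{z_1},\Sigma^\star_{|1})$, where $m^\star_{z_1,i}=m_i+\sigma_{11}^{-1}\sigma_{1i}(z_1-m_1)$ for $i\ge2$ and $\Sigma^\star_{|1}=\mathrm{diag}((\sigma^{22})^{-1},\dots,(\sigma^{dd})^{-1})$. Equivalently $\pi^\star=\mathcal{N}(m,\Sigma^\star)$ with $\sigma^\star_{1i}=\sigma_{1i}$ for $i\in[d]$, $\sigma^\star_{ii}=(\sigma^{ii})^{-1}+\sigma_{1i}^2/\sigma_{11}$ for $i\ge2$, and $\sigma^\star_{ij}=\sigma_{1i}\sigma_{1j}/\sigma_{11}$ for $i\ne j$, $i,j\ge2$.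
   Context: $d\ge2$. $\mathcal{C}_{\rm star}$ is the set of probability measures $\mu$ on $\mathbb{R}^d$ of the form $\mu(\mathrm{d}z)=\mu_1(\mathrm{d}z_1)\prod_{j=2}^d\mu_j(\mathrm{d}z_j\mid z_1)$, i.e. $z_2,\dots,z_d$ conditionally independent given $z_1$; $z_{-1}=(z_2,\dots,z_d)$. KL is relative entropy. *)

theory Defs
  imports "HOL-Probability.Probability"
begin

definition gauss_density :: "real^'n \<Rightarrow> real^'n^'n \<Rightarrow> real^'n \<Rightarrow> real" where
  "gauss_density m S x =
     exp (- ((x - m) \<bullet> (matrix_inv S *v (x - m))) / 2)
     / sqrt ((2 * pi) ^ CARD('n) * det S)"

definition gaussian :: "real^'n \<Rightarrow> real^'n^'n \<Rightarrow> (real^'n) measure" where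
  "gaussian m S = density lborel (\<lambda>x. ennreal (gauss_density m S x))"

definition normal1 :: "real \<Rightarrow> real \<Rightarrow> real measure" where
  "normal1 mu v = density lborel (\<lambda>x. ennreal (normal_density mu (sqrt v) x))"

(* Relative entropy KL(mu || pi) with values in [0, infinity]:
   finite iff mu << pi and log (dmu/dpi) is mu-integrable (equivalently,
   the integral of f log f w.r.t. pi is finite), +infinity otherwise. *)
definition KL_div :: "'a measure \<Rightarrow> 'a measure \<Rightarrow> ereal" where
  "KL_div \<mu> \<pi> =
     (if absolutely_continuous \<pi> \<mu> \<and>
         integrable \<mu> (\<lambda>x. ln (enn2real (RN_deriv \<pi> \<mu> x)))
      then ereal (\<integral>x. ln (enn2real (RN_deriv \<pi> \<mu> x)) \<partial>\<mu>)
      else \<infinity>)"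

(* C_star with distinguished coordinate i0 (the paper's coordinate 1):
   mu(dz) = mu_1(dz_{i0}) prod_{j <> i0} mu_j(dz_j | z_{i0}), with mu_1 a
   probability measure on R and mu_j Markov kernels from R to R.
   The law is characterised by its values on measurable rectangles. *)
definition star_class :: "'n::finite \<Rightarrow> (real^'n) measure set" where
  "star_class i0 = {\<mu>. prob_space \<mu> \<and> sets \<mu> = sets borel \<and>
     (\<exists>(p :: real measure) (K :: 'n \<Rightarrow> real \<Rightarrow> real measure).
        p \<in> space (prob_algebra borel) \<and>
        (\<forall>j. K j \<in> borel \<rightarrow>\<^sub>M prob_algebra borel) \<and>
        (\<forall>A. (\<forall>i. A i \<in> sets borel) \<longrightarrow>
           emeasure \<mu> {z. \<forall>i. z $ i \<in> A i} =
           (\<integral>\<^sup>+ t. indicator (A i0) t * (\<Prod>j\<in>UNIV - {i0}. emeasure (K j t) (A j)) \<partial>p)))}"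

definition Sigma_star :: "'n::finite \<Rightarrow> real^'n^'n \<Rightarrow> real^'n^'n" where
  "Sigma_star i0 S = (\<chi> i j.
     if i = i0 then S $ i0 $ j
     else if j = i0 then S $ i0 $ i
     else if i = j then 1 / (matrix_inv S $ i $ i) + (S $ i0 $ i)^2 / S $ i0 $ i0
     else S $ i0 $ i * S $ i0 $ j / S $ i0 $ i0)"

end

theory Submission
  imports Defs
begin

text \<open>
  For \<open>\<mu>\<close> in the star class with centre marginal \<open>p\<close>, kernels \<open>K\<^sub>j\<close> and kernel means \<open>a\<^sub>j(t)\<close>, let \<open>\<nu>\<close>
  have the centre marginal of \<open>\<pi>\<close> and conditional laws \<open>\<N>(a\<^sub>j(t), 1 / P\<^sub>j\<^sub>j)\<close>, where \<open>P\<close> is the inverse of \<open>S\<close>.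
  If \<open>b(t)\<close> is the vector of differences between \<open>a\<^sub>j(t)\<close> and the conditional mean of \<open>\<pi>\<close>, then conditional
  independence kills all mixed terms of the quadratic form and
  \<open>KL(\<mu>|\<pi>) = KL(\<mu>|\<nu>) + E[b \<bullet> P b] / 2 + KL(\<pi>\<^sup>\<star>|\<pi>)\<close>.
  The first two terms are nonnegative, and both vanish only for \<open>\<mu> = \<pi>\<^sup>\<star>\<close>. The second moments of \<open>\<mu>\<close>
  needed for this are finite because \<open>x y \<le> x ln x - x + exp y\<close> and \<open>\<pi>\<close> has Gaussian exponential moments.
\<close>

section \<open>Star-shaped product measures\<close>

text \<open>The variances 1/P_jj of \<nu> are chosen so that ln(d\<nu>/d\<pi>) carries the squares
  of z_j - a_j with exactly the coefficients that cancel the diagonal of the P-form. The conditional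
  variances of \<mu>, about which nothing is known, thus drop out of the expectation of
  ln(d\<nu>/d\<pi>) under \<mu>. Taking the centre marginal of \<nu> from \<pi> cancels the centre
  terms as well; the divergence of p is absorbed by KL(\<mu>|\<nu>). What remains is the b-term plus
  a constant, half the logarithm of a ratio of determinants. The obstacle is that membership in the
  star class speaks of rectangles only, while the mixed terms are integrals of unbounded signed
  functions. So \<mu> is rebuilt as a mixture of product measures, factorisation is proved for
  nonnegative integrands, and signed ones are reached through positive and negative parts.\<close>

lemma measurable_vec_lambda_PiM:
  "(\<lambda>\<omega>. vec_lambda \<omega> :: real^'n::finite) \<in> (\<Pi>\<^sub>M i\<in>UNIV. borel) \<rightarrow>\<^sub>M borel"
proof -
  have "(\<lambda>\<omega>. vec_lambda \<omega> :: real^'n) = (\<lambda>\<omega>. \<Sum>i\<in>UNIV. \<omega> i *\<^sub>R axis i 1)"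
    by (auto simp: vec_eq_iff axis_def if_distrib sum.delta cong: if_cong)
  then show ?thesis
    by simp
qed

lemma measurable_vec_nth_PiM:
  "(\<lambda>z :: real^'n::finite. vec_nth z) \<in> borel \<rightarrow>\<^sub>M (\<Pi>\<^sub>M i\<in>UNIV. borel)"
  by (rule measurable_PiM_single') auto

lemma sets_rectangle:
  fixes A :: "'n::finite \<Rightarrow> real set"
  assumes "\<And>i. A i \<in> sets borel"
  shows "{z :: real^'n. \<forall>i. z $ i \<in> A i} \<in> sets borel"
  using assms by measurable

text \<open>Rectangles generate the product sigma-algebra on functions, but \<open>real^'n\<close>
  is a separate type. Both measures are pushed along \<open>vec_nth\<close>, compared there and
  brought back by \<open>vec_lambda\<close>.\<close>

lemma measure_eqI_rectangles:
  fixes \<mu> \<nu> :: "(real^'n::finite) measure"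
  assumes "prob_space \<mu>" and sets: "sets \<mu> = sets borel" "sets \<nu> = sets borel"
    and eq: "\<And>A. (\<And>i. A i \<in> sets borel) \<Longrightarrow>
      emeasure \<mu> {z. \<forall>i. z $ i \<in> A i} = emeasure \<nu> {z. \<forall>i. z $ i \<in> A i}"
  shows "\<mu> = \<nu>"
proof -
  interpret prob_space \<mu> by fact
  let ?P = "\<Pi>\<^sub>M i\<in>(UNIV::'n set). (borel :: real measure)"
  have [measurable]: "(\<lambda>z. vec_nth z) \<in> \<mu> \<rightarrow>\<^sub>M ?P" "(\<lambda>z. vec_nth z) \<in> \<nu> \<rightarrow>\<^sub>M ?P"
    using measurable_vec_nth_PiM by (auto cong: measurable_cong_sets simp: sets)
  note [measurable] = measurable_vec_lambda_PiM
  have vim: "(\<lambda>z. vec_nth z) -` (Pi\<^sub>E UNIV A) = {z :: real^'n. \<forall>i. z $ i \<in> A i}" for A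
    by auto
  have sp: "space \<mu> = UNIV" "space \<nu> = UNIV"
    using sets by (auto dest: sets_eq_imp_space_eq)
  have eq': "distr \<mu> ?P (\<lambda>z. vec_nth z) = distr \<nu> ?P (\<lambda>z. vec_nth z)"
  proof (rule measure_eqI_PiM_finite[where I=UNIV and M="\<lambda>_. borel" and A="\<lambda>_. Pi\<^sub>E UNIV (\<lambda>_. UNIV)"])
    fix A :: "'n \<Rightarrow> real set" assume "\<And>i. i \<in> UNIV \<Longrightarrow> A i \<in> sets borel"
    then show "emeasure (distr \<mu> ?P (\<lambda>z. vec_nth z)) (Pi\<^sub>E UNIV A)
        = emeasure (distr \<nu> ?P (\<lambda>z. vec_nth z)) (Pi\<^sub>E UNIV A)"
      by (simp add: emeasure_distr vim sp eq sets_PiM_I_finite)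
  next
    have "Pi\<^sub>E UNIV (\<lambda>_. UNIV) \<in> prod_algebra (UNIV :: 'n set) (\<lambda>_. borel :: real measure)"
      by (rule prod_algebraI_finite) auto
    then show "range (\<lambda>_. Pi\<^sub>E UNIV (\<lambda>_. UNIV)) \<subseteq> prod_algebra (UNIV :: 'n set) (\<lambda>_. borel :: real measure)"
      by auto
  next
    show "emeasure (distr \<mu> ?P (\<lambda>z. vec_nth z)) (Pi\<^sub>E UNIV (\<lambda>_. UNIV)) \<noteq> \<infinity>"
      using finite_measure.emeasure_finite[OF finite_measure_distr, of "\<lambda>z. vec_nth z" ?P] by simp
  qed (auto simp: space_PiM)
  have "\<mu> = distr (distr \<mu> ?P (\<lambda>z. vec_nth z)) borel vec_lambda"
    by (subst distr_distr) (auto simp: comp_def sets intro!: distr_id2[symmetric])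
  also have "\<dots> = \<nu>"
    unfolding eq' by (subst distr_distr) (auto simp: comp_def sets intro!: distr_id2)
  finally show ?thesis .
qed

text \<open>A measure that gives boxes their volume is Lebesgue measure, and
  \<open>vec_lambda\<close> pulls a box back to a product of intervals.\<close>

lemma lborel_vec_eq:
  "(lborel :: (real^'n::finite) measure) = distr (\<Pi>\<^sub>M i\<in>UNIV. lborel) borel vec_lambda"
proof (rule lborel_eqI)
  interpret product_sigma_finite "\<lambda>_::'n. lborel :: real measure" ..
  fix l u :: "real^'n"
  assume le: "\<And>b. b \<in> Basis \<Longrightarrow> l \<bullet> b \<le> u \<bullet> b"
  have le': "l $ i \<le> u $ i" for i
    using le[of "axis i 1"] by (simp add: inner_axis axis_in_Basis_iff)
  have [measurable]: "vec_lambda \<in> (\<Pi>\<^sub>M i\<in>(UNIV::'n set). lborel) \<rightarrow>\<^sub>M (borel :: (real^'n) measure)"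
    using measurable_vec_lambda_PiM by (simp cong: measurable_cong_sets sets_PiM_cong)
  have "vec_lambda -` box l u \<inter> space (\<Pi>\<^sub>M i\<in>(UNIV::'n set). lborel)
      = (\<Pi>\<^sub>E i\<in>UNIV. {l$i <..< u$i})"
    by (auto simp: space_PiM mem_box_cart PiE_iff)
  then have "emeasure (distr (\<Pi>\<^sub>M i\<in>UNIV. lborel) borel vec_lambda) (box l u)
      = (\<Prod>i\<in>UNIV. ennreal (u $ i - l $ i))"
    by (simp add: emeasure_distr emeasure_PiM le')
  also have "\<dots> = ennreal (\<Prod>i\<in>UNIV. u $ i - l $ i)"
    using le' by (simp add: prod_ennreal)
  also have "(\<Prod>i\<in>UNIV. u $ i - l $ i) = (\<Prod>b\<in>Basis. (u - l) \<bullet> b)"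
    unfolding Basis_vec_def
    by (simp add: UNION_singleton_eq_range inner_axis prod.reindex inj_on_def axis_eq_axis)
  finally show "emeasure (distr (\<Pi>\<^sub>M i\<in>UNIV. lborel) borel vec_lambda) (box l u)
      = (\<Prod>b\<in>Basis. (u - l) \<bullet> b)" .
qed simp

text \<open>Tonelli with the centre integrated last: once the centre is fixed at t, the integrand is
  a product of functions of distinct coordinates. Serves both Lebesgue measure and the fibres of a
  star-shaped law.\<close>

lemma (in product_sigma_finite) nn_integral_PiM_star:
  assumes fin: "finite I" "i0 \<in> I"
    and G[measurable]: "G \<in> borel_measurable (M i0)"
    and H[measurable]: "\<And>j. (\<lambda>(t, x). H j t x) \<in> borel_measurable (M i0 \<Otimes>\<^sub>M M j)"
  shows "(\<integral>\<^sup>+\<omega>. G (\<omega> i0) * (\<Prod>j\<in>I - {i0}. H j (\<omega> i0) (\<omega> j)) \<partial>Pi\<^sub>M I M) =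
    (\<integral>\<^sup>+t. G t * (\<Prod>j\<in>I - {i0}. \<integral>\<^sup>+x. H j t x \<partial>M j) \<partial>M i0)"
proof -
  have I: "insert i0 (I - {i0}) = I" using fin by auto
  have [measurable]: "(\<lambda>x. H j (X x) (Y x)) \<in> borel_measurable N"
    if "X \<in> N \<rightarrow>\<^sub>M M i0" "Y \<in> N \<rightarrow>\<^sub>M M j" for X Y j and N :: "'z measure"
    using measurable_compose[OF measurable_Pair[OF that] H[of j]] by simp
  have "(\<integral>\<^sup>+\<omega>. G (\<omega> i0) * (\<Prod>j\<in>I - {i0}. H j (\<omega> i0) (\<omega> j)) \<partial>Pi\<^sub>M (insert i0 (I - {i0})) M)
    = (\<integral>\<^sup>+t. \<integral>\<^sup>+\<omega>. G t * (\<Prod>j\<in>I - {i0}. H j t (\<omega> j)) \<partial>Pi\<^sub>M (I - {i0}) M \<partial>M i0)"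
  proof (subst product_nn_integral_insert_rev)
    show "(\<lambda>\<omega>. G (\<omega> i0) * (\<Prod>j\<in>I - {i0}. H j (\<omega> i0) (\<omega> j)))
      \<in> borel_measurable (Pi\<^sub>M (insert i0 (I - {i0})) M)"
      by measurable
  qed (use fin in \<open>auto intro!: nn_integral_cong prod.cong arg_cong2[where f="(*)"]\<close>)
  also have "\<dots> = (\<integral>\<^sup>+t. G t * (\<Prod>j\<in>I - {i0}. \<integral>\<^sup>+x. H j t x \<partial>M j) \<partial>M i0)"
  proof (intro nn_integral_cong)
    fix t assume [measurable]: "t \<in> space (M i0)"
    show "(\<integral>\<^sup>+\<omega>. G t * (\<Prod>j\<in>I - {i0}. H j t (\<omega> j)) \<partial>Pi\<^sub>M (I - {i0}) M)
      = G t * (\<Prod>j\<in>I - {i0}. \<integral>\<^sup>+x. H j t x \<partial>M j)"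
      using fin by (subst nn_integral_cmult) (auto intro!: arg_cong2[where f="(*)"] product_nn_integral_prod)
  qed
  finally show ?thesis unfolding I .
qed

lemma nn_integral_lborel_star:
  fixes G :: "real \<Rightarrow> ennreal" and H :: "'n::finite \<Rightarrow> real \<Rightarrow> real \<Rightarrow> ennreal"
  assumes [measurable]: "G \<in> borel_measurable borel"
    and H[measurable]: "\<And>j. (\<lambda>(t, x). H j t x) \<in> borel_measurable (borel \<Otimes>\<^sub>M borel)"
  shows "(\<integral>\<^sup>+z. G (z $ i0) * (\<Prod>j\<in>UNIV - {i0}. H j (z $ i0) (z $ j)) \<partial>lborel) =
    (\<integral>\<^sup>+t. G t * (\<Prod>j\<in>UNIV - {i0}. \<integral>\<^sup>+x. H j t x \<partial>lborel) \<partial>lborel)"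
proof -
  interpret product_sigma_finite "\<lambda>_::'n. lborel :: real measure" ..
  have [measurable]: "vec_lambda \<in> (\<Pi>\<^sub>M i\<in>(UNIV::'n set). lborel) \<rightarrow>\<^sub>M (borel :: (real^'n) measure)"
    using measurable_vec_lambda_PiM by (simp cong: measurable_cong_sets sets_PiM_cong)
  have [measurable]: "(\<lambda>x. H j (X x) (Y x)) \<in> borel_measurable N"
    if "X \<in> borel_measurable N" "Y \<in> borel_measurable N" for X Y j and N :: "'z measure"
    using measurable_compose[OF measurable_Pair[OF that] H[of j]] by simp
  have "(\<integral>\<^sup>+z. G (z $ i0) * (\<Prod>j\<in>UNIV - {i0}. H j (z $ i0) (z $ j)) \<partial>lborel)
    = (\<integral>\<^sup>+\<omega>. G (\<omega> i0) * (\<Prod>j\<in>UNIV - {i0}. H j (\<omega> i0) (\<omega> j)) \<partial>(\<Pi>\<^sub>M i\<in>UNIV. lborel))"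
    by (subst lborel_vec_eq, subst nn_integral_distr) simp_all
  also have "\<dots> = (\<integral>\<^sup>+t. G t * (\<Prod>j\<in>UNIV - {i0}. \<integral>\<^sup>+x. H j t x \<partial>lborel) \<partial>lborel)"
    by (rule nn_integral_PiM_star) auto
  finally show ?thesis .
qed

section \<open>Disintegration of a star-shaped law\<close>

locale star_measure =
  fixes i0 :: "'n::finite" and \<mu> :: "(real^'n) measure" and p :: "real measure"
    and K :: "'n \<Rightarrow> real \<Rightarrow> real measure"
  assumes prob_\<mu>: "prob_space \<mu>" and sets_\<mu>: "sets \<mu> = sets borel"
    and p_prob: "p \<in> space (prob_algebra borel)"
    and K_meas: "\<And>j. K j \<in> borel \<rightarrow>\<^sub>M prob_algebra borel"
    and rect: "\<And>A. (\<And>i. A i \<in> sets borel) \<Longrightarrow> emeasure \<mu> {z. \<forall>i. z $ i \<in> A i} =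
      (\<integral>\<^sup>+t. indicator (A i0) t * (\<Prod>j\<in>UNIV - {i0}. emeasure (K j t) (A j)) \<partial>p)"
begin

sublocale prob_space \<mu> by (rule prob_\<mu>)

lemma space_\<mu> [simp]: "space \<mu> = UNIV"
  using sets_\<mu> by (auto dest: sets_eq_imp_space_eq)

lemma measurable_\<mu> [simp]: "f \<in> \<mu> \<rightarrow>\<^sub>M N \<longleftrightarrow> f \<in> borel \<rightarrow>\<^sub>M N"
  by (simp add: sets_\<mu> cong: measurable_cong_sets)

lemma sets_p [simp, measurable_cong]: "sets p = sets borel"
  and space_p [simp]: "space p = UNIV"
  and prob_p: "prob_space p"
  using p_prob by (auto simp: space_prob_algebra dest: sets_eq_imp_space_eq)

lemma sets_K [simp, measurable_cong]: "sets (K j t) = sets borel"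
  and prob_K: "prob_space (K j t)"
  using measurable_space[OF K_meas, of t j] by (auto simp: space_prob_algebra)

lemma space_K [simp]: "space (K j t) = UNIV"
  using sets_K[of j t] by (metis sets_eq_imp_space_eq space_borel)

lemma K_meas_subprob [measurable]: "K j \<in> borel \<rightarrow>\<^sub>M subprob_algebra borel"
  by (rule measurable_prob_algebraD[OF K_meas])

text \<open>Marginals of the conditional law of the whole vector given that the centre is t. The
  Dirac mass at the centre makes this law a product over all coordinates.\<close>

definition fibre :: "real \<Rightarrow> 'n \<Rightarrow> real measure" where
  "fibre t j = (if j = i0 then return borel t else K j t)"

lemma sets_fibre [simp, measurable_cong]: "sets (fibre t j) = sets borel"
  and space_fibre [simp]: "space (fibre t j) = UNIV"
  and prob_fibre: "prob_space (fibre t j)"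
  by (auto simp: fibre_def prob_K intro!: prob_space_return)

lemma product_sigma_finite_fibre: "product_sigma_finite (fibre t)"
  by (simp add: product_sigma_finite_def prob_fibre prob_space_imp_sigma_finite)

text \<open>Checking rectangles suffices, since they form an intersection-stable generator; there
  the mass is a finite product of measurable functions of t.\<close>

lemma measurable_PiM_fibre:
  "(\<lambda>t. Pi\<^sub>M UNIV (fibre t)) \<in> borel \<rightarrow>\<^sub>M prob_algebra (\<Pi>\<^sub>M i\<in>UNIV. borel)"
proof (rule measurable_prob_algebra_generated[OF sets_PiM Int_stable_prod_algebra prod_algebra_sets_into_space])
  fix t
  show "prob_space (Pi\<^sub>M UNIV (fibre t))"
    by (intro prob_space_PiM prob_fibre)
  show "sets (Pi\<^sub>M UNIV (fibre t)) = sets (\<Pi>\<^sub>M i\<in>UNIV. borel)"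
    by (intro sets_PiM_cong) auto
next
  fix X assume "X \<in> prod_algebra UNIV (\<lambda>_::'n. borel :: real measure)"
  then obtain A where A: "X = Pi\<^sub>E UNIV A" "\<And>i. A i \<in> sets borel"
    by (auto simp: prod_algebra_eq_finite)
  note [measurable] = A(2)
  have eq: "emeasure (Pi\<^sub>M UNIV (fibre t)) X = indicator (A i0) t * (\<Prod>j\<in>UNIV - {i0}. emeasure (K j t) (A j))" for t
  proof -
    interpret product_sigma_finite "fibre t" by (rule product_sigma_finite_fibre)
    have "emeasure (Pi\<^sub>M UNIV (fibre t)) X = (\<Prod>j\<in>UNIV. emeasure (fibre t j) (A j))"
      unfolding A(1) using A(2) by (intro emeasure_PiM) auto
    also have "\<dots> = emeasure (fibre t i0) (A i0) * (\<Prod>j\<in>UNIV - {i0}. emeasure (fibre t j) (A j))"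
      by (intro prod.remove) auto
    finally show ?thesis
      using A(2) by (simp add: fibre_def)
  qed
  show "(\<lambda>t. emeasure (Pi\<^sub>M UNIV (fibre t)) X) \<in> borel_measurable borel"
    unfolding eq by measurable
qed

lemma \<mu>_eq_bind:
  "\<mu> = p \<bind> (\<lambda>t. distr (Pi\<^sub>M UNIV (fibre t)) borel vec_lambda)" (is "_ = p \<bind> ?R")
proof (rule measure_eqI_rectangles[OF prob_\<mu> sets_\<mu>])
  have R: "?R \<in> borel \<rightarrow>\<^sub>M prob_algebra borel"
    by (rule measurable_compose[OF measurable_PiM_fibre measurable_distr_prob_space[OF measurable_vec_lambda_PiM]])
  then have R': "?R \<in> p \<rightarrow>\<^sub>M subprob_algebra borel"
    using measurable_prob_algebraD by (simp cong: measurable_cong_sets)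
  show "sets (p \<bind> ?R) = sets borel"
    by (rule sets_bind) auto
  fix A :: "'n \<Rightarrow> real set" assume A: "\<And>i. A i \<in> sets borel"
  have "emeasure (p \<bind> ?R) {z. \<forall>i. z $ i \<in> A i}
    = (\<integral>\<^sup>+t. emeasure (?R t) {z. \<forall>i. z $ i \<in> A i} \<partial>p)"
    by (rule emeasure_bind[OF _ R' sets_rectangle[OF A]]) auto
  also have "\<dots> = (\<integral>\<^sup>+t. indicator (A i0) t * (\<Prod>j\<in>UNIV - {i0}. emeasure (K j t) (A j)) \<partial>p)"
  proof (intro nn_integral_cong)
    fix t
    interpret product_sigma_finite "fibre t" by (rule product_sigma_finite_fibre)
    have m: "vec_lambda \<in> Pi\<^sub>M UNIV (fibre t) \<rightarrow>\<^sub>M (borel :: (real^'n) measure)"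
      using measurable_vec_lambda_PiM by (simp cong: measurable_cong_sets sets_PiM_cong)
    have v: "vec_lambda -` {z. \<forall>i. z $ i \<in> A i} \<inter> space (Pi\<^sub>M UNIV (fibre t)) = Pi\<^sub>E UNIV A"
      by (auto simp: space_PiM PiE_iff)
    have "emeasure (?R t) {z. \<forall>i. z $ i \<in> A i} = emeasure (Pi\<^sub>M UNIV (fibre t)) (Pi\<^sub>E UNIV A)"
      by (simp only: emeasure_distr[OF m sets_rectangle[OF A]] v)
    also have "\<dots> = (\<Prod>j\<in>UNIV. emeasure (fibre t j) (A j))"
      using A by (intro emeasure_PiM) auto
    also have "\<dots> = emeasure (fibre t i0) (A i0) * (\<Prod>j\<in>UNIV - {i0}. emeasure (fibre t j) (A j))"
      by (intro prod.remove) auto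
    finally show "emeasure (?R t) {z. \<forall>i. z $ i \<in> A i}
        = indicator (A i0) t * (\<Prod>j\<in>UNIV - {i0}. emeasure (K j t) (A j))"
      using A by (simp add: fibre_def)
  qed
  finally show "emeasure \<mu> {z. \<forall>i. z $ i \<in> A i} = emeasure (p \<bind> ?R) {z. \<forall>i. z $ i \<in> A i}"
    by (simp add: rect A)
qed

text \<open>The rectangle formula is the case of indicators; the mixture representation extends it
  to factors that may also depend on the centre.\<close>

lemma nn_integral_star:
  assumes [measurable]: "G \<in> borel_measurable borel"
    and H[measurable]: "\<And>j. (\<lambda>(t, x). H j t x) \<in> borel_measurable (borel \<Otimes>\<^sub>M borel)"
  shows "(\<integral>\<^sup>+z. G (z $ i0) * (\<Prod>j\<in>UNIV - {i0}. H j (z $ i0) (z $ j)) \<partial>\<mu>) =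
    (\<integral>\<^sup>+t. G t * (\<Prod>j\<in>UNIV - {i0}. \<integral>\<^sup>+x. H j t x \<partial>K j t) \<partial>p)"
proof -
  let ?R = "\<lambda>t. distr (Pi\<^sub>M UNIV (fibre t)) (borel :: (real^'n) measure) vec_lambda"
  have R: "?R \<in> p \<rightarrow>\<^sub>M subprob_algebra borel"
    using measurable_prob_algebraD[OF measurable_compose[OF measurable_PiM_fibre
      measurable_distr_prob_space[OF measurable_vec_lambda_PiM]]] by (simp cong: measurable_cong_sets)
  have [measurable]: "(\<lambda>x. H j (X x) (Y x)) \<in> borel_measurable N"
    if "X \<in> borel_measurable N" "Y \<in> borel_measurable N" for X Y j and N :: "'z measure"
    using measurable_compose[OF measurable_Pair[OF that] H[of j]] by simp
  have "(\<integral>\<^sup>+z. G (z $ i0) * (\<Prod>j\<in>UNIV - {i0}. H j (z $ i0) (z $ j)) \<partial>\<mu>) =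
    (\<integral>\<^sup>+t. \<integral>\<^sup>+z. G (z $ i0) * (\<Prod>j\<in>UNIV - {i0}. H j (z $ i0) (z $ j)) \<partial>?R t \<partial>p)"
    by (subst \<mu>_eq_bind, rule nn_integral_bind[OF _ R]) measurable
  also have "\<dots> = (\<integral>\<^sup>+t. G t * (\<Prod>j\<in>UNIV - {i0}. \<integral>\<^sup>+x. H j t x \<partial>K j t) \<partial>p)"
  proof (intro nn_integral_cong)
    fix t
    interpret product_sigma_finite "fibre t" by (rule product_sigma_finite_fibre)
    have [measurable]: "vec_lambda \<in> Pi\<^sub>M UNIV (fibre t) \<rightarrow>\<^sub>M (borel :: (real^'n) measure)"
      using measurable_vec_lambda_PiM by (simp cong: measurable_cong_sets sets_PiM_cong)
    have [measurable]: "G \<in> borel_measurable (fibre t i0)" by simp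
    have [measurable]: "(\<lambda>(t, x). H j t x) \<in> borel_measurable (fibre t i0 \<Otimes>\<^sub>M fibre t j)" for j
      using H[of j] by (simp cong: measurable_cong_sets sets_pair_measure_cong)
    have "(\<integral>\<^sup>+z. G (z $ i0) * (\<Prod>j\<in>UNIV - {i0}. H j (z $ i0) (z $ j)) \<partial>?R t)
      = (\<integral>\<^sup>+\<omega>. G (\<omega> i0) * (\<Prod>j\<in>UNIV - {i0}. H j (\<omega> i0) (\<omega> j)) \<partial>Pi\<^sub>M UNIV (fibre t))"
      by (subst nn_integral_distr) simp_all
    also have "\<dots> = (\<integral>\<^sup>+s. G s * (\<Prod>j\<in>UNIV - {i0}. \<integral>\<^sup>+x. H j s x \<partial>fibre t j) \<partial>fibre t i0)"
      by (rule nn_integral_PiM_star) auto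
    also have "\<dots> = (\<integral>\<^sup>+s. G s * (\<Prod>j\<in>UNIV - {i0}. \<integral>\<^sup>+x. H j s x \<partial>K j t) \<partial>return borel t)"
      by (simp add: fibre_def)
    \<comment> \<open>The Dirac mass evaluates the outer integrand at s = t, so that integrand and
      kernel see the same centre value.\<close>
    also have "\<dots> = G t * (\<Prod>j\<in>UNIV - {i0}. \<integral>\<^sup>+x. H j t x \<partial>K j t)"
    proof (subst nn_integral_return)
      have [measurable_cong]: "sets (K j t) = sets borel" for j by simp
      have "(\<lambda>s. \<integral>\<^sup>+x. H j s x \<partial>K j t) \<in> borel_measurable borel" for j
      proof -
        interpret K: prob_space "K j t" by (rule prob_K)
        show ?thesis by measurable
      qed
      then show "(\<lambda>s. G s * (\<Prod>j\<in>UNIV - {i0}. \<integral>\<^sup>+x. H j s x \<partial>K j t)) \<in> borel_measurable borel"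
        by measurable
    qed auto
    finally show "(\<integral>\<^sup>+z. G (z $ i0) * (\<Prod>j\<in>UNIV - {i0}. H j (z $ i0) (z $ j)) \<partial>?R t)
      = G t * (\<Prod>j\<in>UNIV - {i0}. \<integral>\<^sup>+x. H j t x \<partial>K j t)" .
  qed
  finally show ?thesis .
qed

end

section \<open>Second moments under a star-shaped law\<close>

lemma integrable_mult_of_squares:
  fixes X Y :: "'a \<Rightarrow> real"
  assumes [measurable]: "X \<in> borel_measurable M" "Y \<in> borel_measurable M"
    and "integrable M (\<lambda>x. (X x)\<^sup>2)" "integrable M (\<lambda>x. (Y x)\<^sup>2)"
  shows "integrable M (\<lambda>x. X x * Y x)"
proof (rule Bochner_Integration.integrable_bound)
  show "integrable M (\<lambda>x. (X x)\<^sup>2 + (Y x)\<^sup>2)"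
    using assms by auto
  have "\<bar>a * b\<bar> \<le> a\<^sup>2 + b\<^sup>2" for a b :: real
    using sum_squares_bound[of "\<bar>a\<bar>" "\<bar>b\<bar>"] mult_nonneg_nonneg[of "\<bar>a\<bar>" "\<bar>b\<bar>"]
    unfolding abs_mult power2_abs by linarith
  then show "AE x in M. norm (X x * Y x) \<le> norm ((X x)\<^sup>2 + (Y x)\<^sup>2)"
    by auto
qed simp

lemma integrable_square_add:
  fixes X Y :: "'a \<Rightarrow> real"
  assumes [measurable]: "X \<in> borel_measurable M" "Y \<in> borel_measurable M"
    and "integrable M (\<lambda>x. (X x)\<^sup>2)" "integrable M (\<lambda>x. (Y x)\<^sup>2)"
  shows "integrable M (\<lambda>x. (X x + Y x)\<^sup>2)"
  using assms integrable_mult_of_squares[OF assms] by (auto simp: power2_sum mult.assoc)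

lemma integrable_square_diff:
  fixes X Y :: "'a \<Rightarrow> real"
  assumes [measurable]: "X \<in> borel_measurable M" "Y \<in> borel_measurable M"
    and "integrable M (\<lambda>x. (X x)\<^sup>2)" "integrable M (\<lambda>x. (Y x)\<^sup>2)"
  shows "integrable M (\<lambda>x. (X x - Y x)\<^sup>2)"
  using integrable_square_add[of X M "\<lambda>x. - Y x"] assms by simp

text \<open>Zero mean as an equality of nonnegative integrals: in this form it can be multiplied by
  a nonnegative function of the centre and integrated without an integrability check.\<close>

lemma nn_integral_pos_eq_neg:
  fixes f :: "'a \<Rightarrow> real"
  assumes "integrable M f" "(\<integral>x. f x \<partial>M) = 0"
  shows "(\<integral>\<^sup>+x. ennreal (f x) \<partial>M) = (\<integral>\<^sup>+x. ennreal (- f x) \<partial>M)"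
proof -
  have fin: "(\<integral>\<^sup>+x. ennreal (f x) \<partial>M) < \<infinity>" "(\<integral>\<^sup>+x. ennreal (- f x) \<partial>M) < \<infinity>"
    using assms(1) by (auto simp: real_integrable_def less_top)
  have "enn2real (\<integral>\<^sup>+x. ennreal (f x) \<partial>M) = enn2real (\<integral>\<^sup>+x. ennreal (- f x) \<partial>M)"
    using assms by (simp add: real_lebesgue_integral_def)
  then show ?thesis
    using fin by (metis ennreal_enn2real infinity_ennreal_def)
qed

text \<open>Splitting both factors by sign leaves four nonnegative integrals that cancel in pairs. A
  nonintegrable product is covered too, its Bochner integral being 0 by convention.\<close>

lemma integral_mult_eq_0:
  fixes X Y :: "'a \<Rightarrow> real"
  assumes [measurable]: "X \<in> borel_measurable M" "Y \<in> borel_measurable M"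
    and pos: "(\<integral>\<^sup>+x. ennreal (X x) * ennreal (Y x) \<partial>M) = (\<integral>\<^sup>+x. ennreal (X x) * ennreal (- Y x) \<partial>M)"
    and neg: "(\<integral>\<^sup>+x. ennreal (- X x) * ennreal (Y x) \<partial>M) = (\<integral>\<^sup>+x. ennreal (- X x) * ennreal (- Y x) \<partial>M)"
  shows "(\<integral>x. X x * Y x \<partial>M) = 0"
proof (cases "integrable M (\<lambda>x. X x * Y x)")
  case True
  \<comment> \<open>\<open>ennreal\<close> truncates at 0, so \<open>ennreal a\<close> and
    \<open>ennreal (- a)\<close> are the positive and negative parts of \<open>a\<close>.\<close>
  have split: "ennreal (a * b) = ennreal a * ennreal b + ennreal (- a) * ennreal (- b)" for a b :: real
    using ennreal_mult[of a b] ennreal_mult[of "- a" "- b"]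
    by (cases "0 \<le> a"; cases "0 \<le> b")
      (auto simp: ennreal_neg mult_nonneg_nonpos mult_nonpos_nonneg)
  have "(\<integral>\<^sup>+x. ennreal (X x * Y x) \<partial>M)
      = (\<integral>\<^sup>+x. ennreal (X x) * ennreal (Y x) \<partial>M) + (\<integral>\<^sup>+x. ennreal (- X x) * ennreal (- Y x) \<partial>M)"
    unfolding split by (rule nn_integral_add) auto
  also have "\<dots> = (\<integral>\<^sup>+x. ennreal (X x) * ennreal (- Y x) \<partial>M) + (\<integral>\<^sup>+x. ennreal (- X x) * ennreal (Y x) \<partial>M)"
    by (simp add: pos neg)
  also have "\<dots> = (\<integral>\<^sup>+x. ennreal (X x) * ennreal (- Y x) + ennreal (- X x) * ennreal (- (- Y x)) \<partial>M)"
    by (subst nn_integral_add) auto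
  also have "\<dots> = (\<integral>\<^sup>+x. ennreal (X x * - Y x) \<partial>M)"
    unfolding split ..
  finally show ?thesis
    using True by (simp add: real_lebesgue_integral_def)
qed (simp add: not_integrable_integral_eq)

context star_measure
begin

text \<open>Conditional independence of two coordinates. Using \<open>fibre\<close> for the first
  admits \<open>i = i0\<close>, so a residual can be paired with another residual or with a function
  of the centre by one formula.\<close>

lemma nn_integral_pair:
  assumes ij: "i \<noteq> j" "j \<noteq> i0"
    and H[measurable]: "(\<lambda>(t, x). H t x) \<in> borel_measurable (borel \<Otimes>\<^sub>M borel)"
    and H'[measurable]: "(\<lambda>(t, x). H' t x) \<in> borel_measurable (borel \<Otimes>\<^sub>M borel)"
  shows "(\<integral>\<^sup>+z. H (z $ i0) (z $ i) * H' (z $ i0) (z $ j) \<partial>\<mu>) =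
    (\<integral>\<^sup>+t. (\<integral>\<^sup>+x. H t x \<partial>fibre t i) * (\<integral>\<^sup>+x. H' t x \<partial>K j t) \<partial>p)"
proof -
  \<comment> \<open>The star shape has one factor per coordinate: \<open>H'\<close> goes to
    \<open>j\<close>, \<open>H\<close> to \<open>i\<close> or into the centre factor, and the
    remaining factors 1 integrate to the mass 1 of their kernels.\<close>
  define G where "G t = (if i = i0 then H t t else 1)" for t
  define J where "J k = (if k = j then H' else if k = i then H else (\<lambda>_ _. 1))" for k
  have Ht: "(\<lambda>t. H t t) \<in> borel_measurable borel"
    using measurable_compose[OF measurable_Pair[of "\<lambda>t. t" borel borel "\<lambda>t. t" borel] H] by simp
  have [measurable]: "G \<in> borel_measurable borel"
    unfolding G_def using Ht by (cases "i = i0") simp_all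
  have J: "(\<lambda>(t, x). J k t x) \<in> borel_measurable (borel \<Otimes>\<^sub>M borel)" for k
    using H H' by (auto simp: J_def)
  have prod: "(\<Prod>k\<in>UNIV - {i0}. f k) = f j * (if i = i0 then 1 else f i)"
    if "\<And>k. k \<noteq> i \<Longrightarrow> k \<noteq> j \<Longrightarrow> f k = 1" for f :: "'n \<Rightarrow> ennreal"
  proof -
    have "(\<Prod>k\<in>UNIV - {i0}. f k) = (\<Prod>k\<in>{i, j} - {i0}. f k)"
      using that by (intro prod.mono_neutral_right) auto
    then show ?thesis
      using ij by (cases "i = i0") (auto simp: mult.commute insert_Diff_if)
  qed
  have 1: "emeasure (K k t) UNIV = 1" for k t
    using prob_space.emeasure_space_1[OF prob_K[of k t]] by simp
  have "(\<integral>\<^sup>+z. H (z $ i0) (z $ i) * H' (z $ i0) (z $ j) \<partial>\<mu>) =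
      (\<integral>\<^sup>+z. G (z $ i0) * (\<Prod>k\<in>UNIV - {i0}. J k (z $ i0) (z $ k)) \<partial>\<mu>)"
    using ij by (subst prod) (auto simp: J_def G_def mult.commute intro!: nn_integral_cong)
  also have "\<dots> = (\<integral>\<^sup>+t. G t * (\<Prod>k\<in>UNIV - {i0}. \<integral>\<^sup>+x. J k t x \<partial>K k t) \<partial>p)"
    by (rule nn_integral_star) (use J in auto)
  also have "\<dots> = (\<integral>\<^sup>+t. (\<integral>\<^sup>+x. H t x \<partial>fibre t i) * (\<integral>\<^sup>+x. H' t x \<partial>K j t) \<partial>p)"
  proof (intro nn_integral_cong)
    fix t
    have [measurable]: "H t \<in> borel_measurable borel"
      using measurable_compose[OF measurable_Pair1'[of t borel borel] H] by simp
    show "G t * (\<Prod>k\<in>UNIV - {i0}. \<integral>\<^sup>+x. J k t x \<partial>K k t)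
      = (\<integral>\<^sup>+x. H t x \<partial>fibre t i) * (\<integral>\<^sup>+x. H' t x \<partial>K j t)"
      using ij by (subst prod) (auto simp: J_def G_def mult.commute fibre_def 1 nn_integral_return)
  qed
  finally show ?thesis .
qed

lemma nn_integral_single:
  assumes j: "j \<noteq> i0" and H: "(\<lambda>(t, x). H t x) \<in> borel_measurable (borel \<Otimes>\<^sub>M borel)"
  shows "(\<integral>\<^sup>+z. H (z $ i0) (z $ j) \<partial>\<mu>) = (\<integral>\<^sup>+t. \<integral>\<^sup>+x. H t x \<partial>K j t \<partial>p)"
  using nn_integral_pair[of i0 j "\<lambda>_ _. 1" H] assms
    prob_space.emeasure_space_1[OF prob_fibre] by simp

lemma distr_centre: "distr \<mu> borel (\<lambda>z. z $ i0) = p"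
proof (rule measure_eqI)
  fix X assume "X \<in> sets (distr \<mu> borel (\<lambda>z. z $ i0))"
  then have [measurable]: "X \<in> sets borel" by simp
  define A where "A i = (if i = i0 then X else UNIV)" for i
  have A: "A i \<in> sets borel" for i by (simp add: A_def)
  have "emeasure (distr \<mu> borel (\<lambda>z. z $ i0)) X = emeasure \<mu> {z. \<forall>i. z $ i \<in> A i}"
    by (auto simp: emeasure_distr A_def intro!: arg_cong[where f="emeasure \<mu>"])
  also have "\<dots> = (\<integral>\<^sup>+t. indicator X t * (\<Prod>j\<in>UNIV - {i0}. emeasure (K j t) (A j)) \<partial>p)"
    using rect[OF A] by (simp add: A_def)
  also have "\<dots> = (\<integral>\<^sup>+t. indicator X t \<partial>p)"
    using prob_space.emeasure_space_1[OF prob_K]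
    by (intro nn_integral_cong) (simp add: A_def prod.neutral)
  finally show "emeasure (distr \<mu> borel (\<lambda>z. z $ i0)) X = emeasure p X"
    by simp
qed simp

text \<open>Total by the Bochner convention: 0 where the kernel has no first moment. Finite second
  moments of \<mu> confine this to a \<open>p\<close>-null set for
  \<open>j \<noteq> i0\<close>.\<close>

definition mean :: "'n \<Rightarrow> real \<Rightarrow> real" where
  "mean j t = (\<integral>x. x \<partial>K j t)"

lemma measurable_mean [measurable]: "mean j \<in> borel_measurable borel"
  unfolding mean_def by measurable

text \<open>The entry 0 at the centre lets quadratic forms and diagonal sums run over
  \<open>UNIV\<close>.\<close>

definition resid :: "real^'n \<Rightarrow> real^'n" where
  "resid z = (\<chi> j. if j = i0 then 0 else z $ j - mean j (z $ i0))"

lemma measurable_resid [measurable]: "(\<lambda>z. resid z $ j) \<in> borel_measurable borel"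
  by (simp add: resid_def)

context
  assumes L2: "\<And>j. integrable \<mu> (\<lambda>z. (z $ j)\<^sup>2)"
begin

lemma AE_square_integrable_K:
  assumes j: "j \<noteq> i0"
  shows "AE t in p. integrable (K j t) (\<lambda>x. x\<^sup>2)"
proof -
  have "(\<integral>\<^sup>+t. \<integral>\<^sup>+x. ennreal (x\<^sup>2) \<partial>K j t \<partial>p) = (\<integral>\<^sup>+z. ennreal ((z $ j)\<^sup>2) \<partial>\<mu>)"
    by (rule nn_integral_single[OF j, symmetric]) simp
  also have "\<dots> < \<infinity>"
    using L2[of j] by (simp add: integrable_iff_bounded)
  finally have "AE t in p. (\<integral>\<^sup>+x. ennreal (x\<^sup>2) \<partial>K j t) \<noteq> \<infinity>"
    by (intro nn_integral_noteq_infinite) auto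
  then show ?thesis
    by eventually_elim (auto simp: integrable_iff_bounded less_top)
qed

text \<open>Jensen for the square, read off from the nonnegative variance of the kernel.\<close>

lemma AE_mean_K:
  assumes j: "j \<noteq> i0"
  shows "AE t in p. integrable (K j t) (\<lambda>x. x) \<and> ennreal ((mean j t)\<^sup>2) \<le> (\<integral>\<^sup>+x. ennreal (x\<^sup>2) \<partial>K j t)"
  using AE_square_integrable_K[OF j]
proof eventually_elim
  case (elim t)
  interpret K: prob_space "K j t" by (rule prob_K)
  have int: "integrable (K j t) (\<lambda>x. x)"
    by (rule K.square_integrable_imp_integrable[OF _ elim]) simp
  have "0 \<le> K.variance (\<lambda>x. x)" by simp
  then have "(mean j t)\<^sup>2 \<le> (\<integral>x. x\<^sup>2 \<partial>K j t)"
    using K.variance_eq[OF int elim] by (simp add: mean_def)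
  also have "ennreal \<dots> = (\<integral>\<^sup>+x. ennreal (x\<^sup>2) \<partial>K j t)"
    by (rule nn_integral_eq_integral[symmetric, OF elim]) simp
  finally show ?case using int by (simp add: ennreal_leI)
qed

lemma integrable_mean_square:
  assumes j: "j \<noteq> i0"
  shows "integrable \<mu> (\<lambda>z. (mean j (z $ i0))\<^sup>2)"
proof (rule integrableI_nonneg)
  have "(\<integral>\<^sup>+z. ennreal ((mean j (z $ i0))\<^sup>2) \<partial>\<mu>) = (\<integral>\<^sup>+t. ennreal ((mean j t)\<^sup>2) \<partial>p)"
    by (subst distr_centre[symmetric], subst nn_integral_distr) auto
  also have "\<dots> \<le> (\<integral>\<^sup>+t. \<integral>\<^sup>+x. ennreal (x\<^sup>2) \<partial>K j t \<partial>p)"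
    using AE_mean_K[OF j] by (intro nn_integral_mono_AE) auto
  also have "\<dots> = (\<integral>\<^sup>+z. ennreal ((z $ j)\<^sup>2) \<partial>\<mu>)"
    by (rule nn_integral_single[OF j, symmetric]) simp
  also have "\<dots> < \<infinity>"
    using L2[of j] by (simp add: integrable_iff_bounded)
  finally show "(\<integral>\<^sup>+z. ennreal ((mean j (z $ i0))\<^sup>2) \<partial>\<mu>) < \<infinity>" .
qed auto

text \<open>Given the centre, the two coordinates are independent and the second factor has mean
  0.\<close>

lemma integral_mult_centred:
  assumes ij: "i \<noteq> j" "j \<noteq> i0"
    and F[measurable]: "(\<lambda>(t, x). F t x) \<in> borel_measurable (borel \<Otimes>\<^sub>M borel)"
  shows "(\<integral>z. F (z $ i0) (z $ i) * (z $ j - mean j (z $ i0)) \<partial>\<mu>) = 0"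
proof (rule integral_mult_eq_0)
  have Fm: "(\<lambda>z. F (z $ i0) (z $ i)) \<in> borel_measurable borel"
    using measurable_compose[OF measurable_Pair[of "\<lambda>z. z $ i0" borel borel "\<lambda>z. z $ i" borel] F] by simp
  show "(\<lambda>z. F (z $ i0) (z $ i)) \<in> borel_measurable \<mu>"
    using Fm by simp
  have K0: "AE t in p. (\<integral>\<^sup>+x. ennreal (x - mean j t) \<partial>K j t) = (\<integral>\<^sup>+x. ennreal (- (x - mean j t)) \<partial>K j t)"
    using AE_mean_K[OF ij(2)]
  proof eventually_elim
    case (elim t)
    interpret K: prob_space "K j t" by (rule prob_K)
    show ?case
      using elim K.prob_space by (intro nn_integral_pos_eq_neg) (auto simp: mean_def)
  qed
  \<comment> \<open>The signs \<open>s = 1\<close> and \<open>s = -1\<close> yield the positive and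
    the negative part of \<open>F\<close>.\<close>
  have *: "(\<integral>\<^sup>+z. ennreal (s * F (z $ i0) (z $ i)) * ennreal (z $ j - mean j (z $ i0)) \<partial>\<mu>) =
    (\<integral>\<^sup>+z. ennreal (s * F (z $ i0) (z $ i)) * ennreal (- (z $ j - mean j (z $ i0))) \<partial>\<mu>)" for s :: real
  proof -
    have sF: "(\<lambda>(t, x). ennreal (s * F t x)) \<in> borel_measurable (borel \<Otimes>\<^sub>M borel)"
      by measurable
    show ?thesis
      using nn_integral_pair[OF ij sF, of "\<lambda>t x. ennreal (x - mean j t)"]
        nn_integral_pair[OF ij sF, of "\<lambda>t x. ennreal (- (x - mean j t))"] K0
      by (simp del: minus_diff_eq) (rule nn_integral_cong_AE, auto)
  qed
  show "(\<integral>\<^sup>+z. ennreal (F (z $ i0) (z $ i)) * ennreal (z $ j - mean j (z $ i0)) \<partial>\<mu>) =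
    (\<integral>\<^sup>+z. ennreal (F (z $ i0) (z $ i)) * ennreal (- (z $ j - mean j (z $ i0))) \<partial>\<mu>)"
    using *[of 1] by simp
  show "(\<integral>\<^sup>+z. ennreal (- F (z $ i0) (z $ i)) * ennreal (z $ j - mean j (z $ i0)) \<partial>\<mu>) =
    (\<integral>\<^sup>+z. ennreal (- F (z $ i0) (z $ i)) * ennreal (- (z $ j - mean j (z $ i0))) \<partial>\<mu>)"
    using *[of "-1"] by simp
qed simp

lemma integrable_resid_square: "integrable \<mu> (\<lambda>z. (resid z $ j)\<^sup>2)"
  using integrable_square_diff[of "\<lambda>z. z $ j" \<mu> "\<lambda>z. mean j (z $ i0)"] L2[of j]
    integrable_mean_square[of j] by (cases "j = i0") (auto simp: resid_def)

lemma integral_resid_mult: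
  assumes "i \<noteq> j"
  shows "(\<integral>z. resid z $ i * resid z $ j \<partial>\<mu>) = 0"
  using integral_mult_centred[of i j "\<lambda>t x. x - mean i t"] assms
  by (cases "i = i0 \<or> j = i0") (auto simp: resid_def)

lemma integral_centre_mult_resid:
  assumes [measurable]: "\<phi> \<in> borel_measurable borel"
  shows "(\<integral>z. \<phi> (z $ i0) * resid z $ j \<partial>\<mu>) = 0"
  using integral_mult_centred[of i0 j "\<lambda>t x. \<phi> t"]
  by (cases "j = i0") (auto simp: resid_def)

text \<open>Products of distinct residuals, and of a residual with a function of the centre, have
  mean 0. The subtracted diagonal sum removes the squared residuals, so only the form in
  \<open>b\<close> survives.\<close>

lemma quadratic_form_integral:
  fixes b :: "real \<Rightarrow> real^'n" and P :: "real^'n^'n"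
  assumes b[measurable]: "\<And>j. (\<lambda>t. b t $ j) \<in> borel_measurable borel"
    and b2: "\<And>j. integrable \<mu> (\<lambda>z. (b (z $ i0) $ j)\<^sup>2)"
  defines "w \<equiv> \<lambda>z. resid z + b (z $ i0)"
  shows "integrable \<mu> (\<lambda>z. w z \<bullet> (P *v w z) - (\<Sum>j\<in>UNIV. P $ j $ j * (resid z $ j)\<^sup>2))"
    and "integrable \<mu> (\<lambda>z. b (z $ i0) \<bullet> (P *v b (z $ i0)))"
    and "(\<integral>z. w z \<bullet> (P *v w z) - (\<Sum>j\<in>UNIV. P $ j $ j * (resid z $ j)\<^sup>2) \<partial>\<mu>) =
      (\<integral>z. b (z $ i0) \<bullet> (P *v b (z $ i0)) \<partial>\<mu>)"
proof -
  have Q: "x \<bullet> (P *v x) = (\<Sum>i\<in>UNIV. \<Sum>j\<in>UNIV. P $ i $ j * (x $ i * x $ j))" for x :: "real^'n"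
    by (simp add: inner_vec_def matrix_vector_mult_def sum_distrib_left mult_ac)
  have vv: "integrable \<mu> (\<lambda>z. resid z $ i * resid z $ j)"
    and vb: "integrable \<mu> (\<lambda>z. b (z $ i0) $ i * resid z $ j)"
    and bb: "integrable \<mu> (\<lambda>z. b (z $ i0) $ i * b (z $ i0) $ j)" for i j
    by (intro integrable_mult_of_squares integrable_resid_square b2; simp)+
  have exp: "w z $ i * w z $ j = resid z $ i * resid z $ j + b (z $ i0) $ i * resid z $ j
      + b (z $ i0) $ j * resid z $ i + b (z $ i0) $ i * b (z $ i0) $ j" for z i j
    by (simp add: w_def algebra_simps)
  have ww: "integrable \<mu> (\<lambda>z. w z $ i * w z $ j)" for i j
    unfolding exp using vv vb bb by simp
  have Eww: "(\<integral>z. w z $ i * w z $ j \<partial>\<mu>) = (if i = j then \<integral>z. (resid z $ j)\<^sup>2 \<partial>\<mu> else 0)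
      + (\<integral>z. b (z $ i0) $ i * b (z $ i0) $ j \<partial>\<mu>)" for i j
    unfolding exp using vv vb bb integral_resid_mult[of i j]
    by (simp add: integral_centre_mult_resid[OF b] power2_eq_square)
  show int: "integrable \<mu> (\<lambda>z. w z \<bullet> (P *v w z) - (\<Sum>j\<in>UNIV. P $ j $ j * (resid z $ j)\<^sup>2))"
    unfolding Q using ww integrable_resid_square by simp
  show "integrable \<mu> (\<lambda>z. b (z $ i0) \<bullet> (P *v b (z $ i0)))"
    unfolding Q using bb by simp
  show "(\<integral>z. w z \<bullet> (P *v w z) - (\<Sum>j\<in>UNIV. P $ j $ j * (resid z $ j)\<^sup>2) \<partial>\<mu>) =
      (\<integral>z. b (z $ i0) \<bullet> (P *v b (z $ i0)) \<partial>\<mu>)"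
    unfolding Q using ww integrable_resid_square bb
    by (simp add: Eww distrib_left sum.distrib if_distrib[of "\<lambda>x. _ * x"] cong: if_cong)
qed

end

end

section \<open>Positive definite matrices and Gaussian densities\<close>

locale spd =
  fixes S :: "real^'n^'n::finite"
  assumes sym: "transpose S = S"
    and pos: "\<And>x. x \<noteq> 0 \<Longrightarrow> 0 < x \<bullet> (S *v x)"
begin

abbreviation P :: "real^'n^'n" where "P \<equiv> matrix_inv S"

lemma entry_sym: "S $ i $ j = S $ j $ i"
  using sym by (metis transpose_def vec_lambda_beta)

lemma inner_sym: "x \<bullet> (S *v y) = (S *v x) \<bullet> y"
  by (metis dot_lmul_matrix sym vector_transpose_matrix)

lemma invertible: "invertible S"
proof -
  have "x = 0" if "S *v x = 0" for x
    using pos[of x] that by fastforce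
  then show ?thesis
    by (auto simp: invertible_left_inverse matrix_left_invertible_ker)
qed

lemma matrix_inv_mult: "S ** P = mat 1" "P ** S = mat 1"
  using someI_ex[OF invertible[unfolded invertible_def]] by (auto simp: matrix_inv_def)

lemma mult_inv_vec [simp]: "S *v (P *v x) = x" "P *v (S *v x) = x"
  by (simp_all add: matrix_vector_mul_assoc matrix_inv_mult)

lemma inv_pos:
  assumes "x \<noteq> 0"
  shows "0 < x \<bullet> (P *v x)"
proof -
  have "P *v x \<noteq> 0"
    using assms mult_inv_vec(1)[of x] by force
  from pos[OF this] show ?thesis
    by (simp add: inner_commute)
qed

lemma inner_axis_mult: "axis i 1 \<bullet> (M *v axis j 1) = (M :: real^'n^'n) $ i $ j"
  by (simp add: inner_axis' matrix_vector_mul_component inner_axis)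

lemma diag_pos: "0 < S $ i $ i" and inv_diag_pos: "0 < P $ i $ i"
  using pos[of "axis i 1"] inv_pos[of "axis i 1"]
  by (simp_all add: inner_axis_mult axis_eq_0_iff)

text \<open>The segment from the identity to \<open>S\<close> consists of positive definite, hence
  nonsingular, matrices. The determinant starts at 1 and would vanish on the way if
  \<open>det S\<close> were not positive.\<close>

lemma det_pos: "0 < det S"
proof (rule ccontr)
  assume neg: "\<not> 0 < det S"
  define f where "f t = det (\<chi> i j. (1 - t) * (mat 1 :: real^'n^'n) $ i $ j + t * S $ i $ j)" for t :: real
  have "continuous_on {0..1} f"
    unfolding f_def det_def by (simp, intro continuous_intros)
  moreover have "f 1 \<le> 0" "0 \<le> f 0"
    using neg by (simp_all add: f_def vec_nth_inverse det_I)
  ultimately obtain t where t: "0 \<le> t" "t \<le> 1" "f t = 0"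
    using IVT2'[of f 1 0 0] by auto
  let ?M = "\<chi> i j. (1 - t) * (mat 1 :: real^'n^'n) $ i $ j + t * S $ i $ j"
  have M: "?M *v x = (1 - t) *\<^sub>R x + t *\<^sub>R (S *v x)" for x
    by (simp add: vec_eq_iff matrix_vector_mult_def mat_def distrib_right sum.distrib sum_distrib_left
        if_distrib[of "\<lambda>x. _ * x"] if_distrib[of "\<lambda>x. x * _"] mult.assoc sum.delta cong: if_cong)
  have "x = 0" if "?M *v x = 0" for x
  proof (rule ccontr)
    assume x: "x \<noteq> 0"
    have "0 = (1 - t) * (x \<bullet> x) + t * (x \<bullet> (S *v x))"
      using that unfolding M by (metis inner_add_right inner_scaleR_right inner_zero_right)
    \<comment> \<open>Nonnegative terms with sum 0 both vanish, but \<open>1 - t\<close> and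
      \<open>t\<close> are not both 0.\<close>
    moreover have "0 \<le> (1 - t) * (x \<bullet> x)" "0 \<le> t * (x \<bullet> (S *v x))"
      using t pos[OF x] by auto
    ultimately have "(1 - t) * (x \<bullet> x) = 0" "t * (x \<bullet> (S *v x)) = 0" by linarith+
    then show False
      using x pos[OF x] by auto
  qed
  then have "invertible ?M"
    by (auto simp: invertible_left_inverse matrix_left_invertible_ker)
  then show False
    using t(3) by (simp add: invertible_det_nz f_def)
qed

text \<open>The constant is the minimum of the form on the compact unit sphere; homogeneity of
  degree 2 does the rest.\<close>

lemma inv_coercive: "\<exists>\<delta>>0. \<forall>x. \<delta> * (x \<bullet> x) \<le> x \<bullet> (P *v x)"
proof -
  have cont: "continuous_on (sphere 0 1) (\<lambda>x. x \<bullet> (P *v x))"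
    by (intro continuous_intros)
  have "axis undefined 1 \<in> sphere (0 :: real^'n) 1"
    by simp
  then obtain x0 where x0: "x0 \<in> sphere 0 1" "\<And>x. x \<in> sphere 0 1 \<Longrightarrow> x0 \<bullet> (P *v x0) \<le> x \<bullet> (P *v x)"
    using continuous_attains_inf[OF compact_sphere _ cont] by blast
  have "x0 \<noteq> 0" using x0 by auto
  have "(x0 \<bullet> (P *v x0)) * (x \<bullet> x) \<le> x \<bullet> (P *v x)" for x
  proof (cases "x = 0")
    case False
    let ?y = "(1 / norm x) *\<^sub>R x"
    have "x0 \<bullet> (P *v x0) \<le> ?y \<bullet> (P *v ?y)"
      using False by (intro x0) simp
    also have "?y \<bullet> (P *v ?y) = (x \<bullet> (P *v x)) / (x \<bullet> x)"
      by (simp add: matrix_vector_mult_scaleR dot_square_norm power2_eq_square)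
    finally show ?thesis
      using False by (simp add: field_simps)
  qed simp
  then show ?thesis
    using inv_pos[OF \<open>x0 \<noteq> 0\<close>] by blast
qed

text \<open>The Schur complement decomposition of the precision form with respect to coordinate \<open>i0\<close>.\<close>
lemma inv_form_split:
  fixes x :: "real^'n" and i0 :: 'n
  defines "y \<equiv> x - (x $ i0 / S $ i0 $ i0) *\<^sub>R (S *v axis i0 1)"
  shows "x \<bullet> (P *v x) = (x $ i0)\<^sup>2 / S $ i0 $ i0 + y \<bullet> (P *v y)"
proof -
  let ?e = "axis i0 1 :: real^'n" and ?c = "x $ i0 / S $ i0 $ i0"
  have Py: "P *v y = P *v x - ?c *\<^sub>R ?e"
    by (simp add: y_def matrix_vector_mult_diff_distrib matrix_vector_mult_scaleR)
  have "(S *v ?e) \<bullet> (P *v x) = x $ i0"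
    by (simp add: inner_sym[symmetric] inner_axis')
  moreover have "(S *v ?e) \<bullet> ?e = S $ i0 $ i0"
    by (simp add: inner_commute[of _ ?e] inner_axis_mult)
  moreover have "x \<bullet> ?e = x $ i0"
    by (simp add: inner_axis)
  moreover have "y \<bullet> (P *v y) = x \<bullet> (P *v x) - ?c * (x \<bullet> ?e) - ?c * ((S *v ?e) \<bullet> (P *v x))
      + ?c * (?c * ((S *v ?e) \<bullet> ?e))"
    unfolding Py unfolding y_def by (simp add: inner_diff_left inner_diff_right algebra_simps)
  ultimately have "y \<bullet> (P *v y) = x \<bullet> (P *v x) - 2 * ?c * (x $ i0) + ?c\<^sup>2 * S $ i0 $ i0"
    by (simp only: power2_eq_square mult.assoc)
  then show ?thesis
    using diag_pos[of i0] by (simp add: field_simps power2_eq_square)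
qed

lemma gauss_density_pos: "0 < gauss_density m S x"
  using det_pos by (simp add: gauss_density_def)

lemma measurable_gauss_density [measurable]: "gauss_density m S \<in> borel_measurable borel"
proof -
  have "continuous_on UNIV (\<lambda>x. exp (- ((x - m) \<bullet> (P *v (x - m))) / 2)
     / sqrt ((2 * pi) ^ CARD('n) * det S))"
    unfolding matrix_vector_mult_diff_distrib
    by (intro continuous_intros) (use det_pos in auto)
  then have "continuous_on UNIV (gauss_density m S)"
    by (simp add: gauss_density_def[abs_def])
  then show ?thesis
    by (rule borel_measurable_continuous_onI)
qed

lemma sets_gaussian [simp, measurable_cong]: "sets (gaussian m S) = sets borel"
  and space_gaussian [simp]: "space (gaussian m S) = UNIV"
  by (simp_all add: gaussian_def)

lemma gaussian_exp_moment:
  "\<exists>\<epsilon>>0. (\<integral>\<^sup>+z. ennreal (exp (\<epsilon> * ((z - m) \<bullet> (z - m)))) \<partial>gaussian m S) < \<infinity>"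
proof -
  obtain \<delta> where \<delta>: "\<delta> > 0" "\<And>x. \<delta> * (x \<bullet> x) \<le> x \<bullet> (P *v x)"
    using inv_coercive by blast
  \<comment> \<open>The exponent of the density is at most -\<delta>/2 = -2\<epsilon> times the
    squared distance; the moment costs one \<epsilon> and leaves Gaussian decay of rate
    \<epsilon>.\<close>
  define \<epsilon> where "\<epsilon> = \<delta> / 4"
  define c where "c = 1 / sqrt ((2 * pi) ^ CARD('n) * det S)"
  \<comment> \<open>The standard deviation whose normal density is a multiple of
    \<open>exp (- \<epsilon> * (x - a)\<^sup>2)\<close>.\<close>
  define \<sigma> where "\<sigma> = sqrt (1 / (2 * \<epsilon>))"
  have \<epsilon>: "\<epsilon> > 0" and c: "c > 0" and \<sigma>: "\<sigma> > 0" "\<sigma>\<^sup>2 = 1 / (2 * \<epsilon>)"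
    using \<delta> det_pos by (auto simp: \<epsilon>_def c_def \<sigma>_def)
  have 1: "(\<integral>\<^sup>+x. ennreal (exp (- \<epsilon> * (x - a)\<^sup>2)) \<partial>lborel) < \<infinity>" for a
  proof -
    have "exp (- \<epsilon> * (x - a)\<^sup>2) = sqrt (2 * pi * \<sigma>\<^sup>2) * normal_density a \<sigma> x" for x
      using \<epsilon> \<sigma> by (simp add: normal_density_def field_simps)
    then have "integrable lborel (\<lambda>x. exp (- \<epsilon> * (x - a)\<^sup>2))"
      using \<sigma> by simp
    then show ?thesis
      by (simp add: integrable_iff_bounded)
  qed
  have bound: "gauss_density m S z * exp (\<epsilon> * ((z - m) \<bullet> (z - m)))
      \<le> c * (\<Prod>i\<in>UNIV. exp (- \<epsilon> * (z $ i - m $ i)\<^sup>2))" for z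
  proof -
    have "gauss_density m S z * exp (\<epsilon> * ((z - m) \<bullet> (z - m)))
        = c * exp (\<epsilon> * ((z - m) \<bullet> (z - m)) + - ((z - m) \<bullet> (P *v (z - m))) / 2)"
      unfolding exp_add by (simp add: gauss_density_def c_def)
    also have "\<dots> \<le> c * exp (- \<epsilon> * ((z - m) \<bullet> (z - m)))"
      using \<delta>(2)[of "z - m"] c by (auto simp: \<epsilon>_def)
    also have "- \<epsilon> * ((z - m) \<bullet> (z - m)) = (\<Sum>i\<in>UNIV. - \<epsilon> * (z $ i - m $ i)\<^sup>2)"
      by (simp add: inner_vec_def sum_distrib_left sum_negf power2_eq_square)
    finally show ?thesis
      by (simp add: exp_sum)
  qed
  \<comment> \<open>Any coordinate can act as centre: the factors do not depend on it, and the star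
    formula reduces to plain Tonelli.\<close>
  obtain i0 :: 'n where True by simp
  define h where "h i x = exp (- \<epsilon> * (x - m $ i)\<^sup>2)" for i x
  have [measurable]: "h i \<in> borel_measurable borel" for i
    unfolding h_def by simp
  have "(\<integral>\<^sup>+z. ennreal (exp (\<epsilon> * ((z - m) \<bullet> (z - m)))) \<partial>gaussian m S)
      = (\<integral>\<^sup>+z. ennreal (gauss_density m S z) * ennreal (exp (\<epsilon> * ((z - m) \<bullet> (z - m)))) \<partial>lborel)"
    unfolding gaussian_def by (subst nn_integral_density) auto
  also have "\<dots> \<le> (\<integral>\<^sup>+z. ennreal c * (\<Prod>i\<in>UNIV. ennreal (h i (z $ i))) \<partial>lborel)"
    using bound c gauss_density_pos[of m]
    by (intro nn_integral_mono)
      (simp add: ennreal_mult[symmetric] prod_ennreal prod_nonneg h_def less_imp_le)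
  also have "\<dots> = (\<integral>\<^sup>+z. ennreal c * ennreal (h i0 (z $ i0)) * (\<Prod>i\<in>UNIV - {i0}. ennreal (h i (z $ i))) \<partial>lborel)"
    by (simp add: prod.remove[of UNIV i0] mult.assoc)
  also have "\<dots> = (\<integral>\<^sup>+t. ennreal c * ennreal (h i0 t) * (\<Prod>i\<in>UNIV - {i0}. \<integral>\<^sup>+x. ennreal (h i x) \<partial>lborel) \<partial>lborel)"
    by (rule nn_integral_lborel_star) auto
  also have "\<dots> = (\<Prod>i\<in>UNIV - {i0}. \<integral>\<^sup>+x. ennreal (h i x) \<partial>lborel) * (ennreal c * (\<integral>\<^sup>+t. ennreal (h i0 t) \<partial>lborel))"
    by (subst nn_integral_multc) (auto simp: nn_integral_cmult mult.commute)
  also have "\<dots> < \<infinity>"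
  proof -
    have h: "(\<integral>\<^sup>+x. ennreal (h i x) \<partial>lborel) \<noteq> top" for i
      using 1[of "m $ i"] by (simp add: h_def)
    then have "(\<Prod>i\<in>UNIV - {i0}. \<integral>\<^sup>+x. ennreal (h i x) \<partial>lborel) \<noteq> top"
      by (simp add: ennreal_prod_eq_top)
    with h show ?thesis
      by (simp add: ennreal_mult_less_top less_top)
  qed
  finally show ?thesis
    using \<epsilon> by blast
qed

text \<open>The exponential moment dominates the mass. Finiteness gives the sigma-finiteness
  required by the Radon-Nikodym lemmas on \<open>KL_div\<close>.\<close>

lemma finite_measure_gaussian: "finite_measure (gaussian m S)"
proof (rule finite_measureI)
  obtain \<epsilon> where \<epsilon>: "\<epsilon> > 0" "(\<integral>\<^sup>+z. ennreal (exp (\<epsilon> * ((z - m) \<bullet> (z - m)))) \<partial>gaussian m S) < \<infinity>"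
    using gaussian_exp_moment by blast
  have "emeasure (gaussian m S) (space (gaussian m S)) = (\<integral>\<^sup>+z. 1 \<partial>gaussian m S)"
    by simp
  also have "\<dots> \<le> (\<integral>\<^sup>+z. ennreal (exp (\<epsilon> * ((z - m) \<bullet> (z - m)))) \<partial>gaussian m S)"
    using \<epsilon>(1) by (intro nn_integral_mono) simp
  finally show "emeasure (gaussian m S) (space (gaussian m S)) \<noteq> \<infinity>"
    using \<epsilon>(2) by auto
qed

end

section \<open>The matrix of the minimizer\<close>

lemma sqrt_prod: "sqrt (\<Prod>i\<in>I. f i) = (\<Prod>i\<in>I. sqrt (f i))"
  by (induction I rule: infinite_finite_induct) (auto simp: real_sqrt_mult)

context spd
begin

text \<open>The structure behind the entrywise definition: a rank-one matrix built from row
  \<open>i0\<close> of \<open>S\<close>, plus a diagonal matrix with 0 at the centre and the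
  inverses of \<open>P $ i $ i\<close> elsewhere.\<close>

lemma Sigma_star_mult:
  "(Sigma_star i0 S *v v) $ i =
    S $ i0 $ i / S $ i0 $ i0 * (\<Sum>j\<in>UNIV. S $ i0 $ j * v $ j) + (if i = i0 then 0 else v $ i / P $ i $ i)"
proof -
  have s: "S $ i0 $ i0 \<noteq> 0"
    using diag_pos[of i0] by simp
  have "Sigma_star i0 S $ i $ j * v $ j = S $ i0 $ i / S $ i0 $ i0 * (S $ i0 $ j * v $ j)
      + (if j = i then if i = i0 then 0 else v $ i / P $ i $ i else 0)" for j
    using s by (auto simp: Sigma_star_def field_simps power2_eq_square)
  then have "(Sigma_star i0 S *v v) $ i = (\<Sum>j\<in>UNIV. S $ i0 $ i / S $ i0 $ i0 * (S $ i0 $ j * v $ j)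
      + (if j = i then if i = i0 then 0 else v $ i / P $ i $ i else 0))"
    by (simp add: matrix_vector_mult_def)
  then show ?thesis
    by (simp add: sum.distrib sum_distrib_left)
qed

lemma spd_Sigma_star: "spd (Sigma_star i0 S)"
proof
  show "transpose (Sigma_star i0 S) = Sigma_star i0 S"
    by (auto simp: transpose_def Sigma_star_def vec_eq_iff)
next
  fix v :: "real^'n" assume v: "v \<noteq> 0"
  define u where "u = (\<Sum>j\<in>UNIV. S $ i0 $ j * v $ j)"
  have "v \<bullet> (Sigma_star i0 S *v v) =
      (\<Sum>i\<in>UNIV. v $ i * (S $ i0 $ i / S $ i0 $ i0 * u) + (if i = i0 then 0 else (v $ i)\<^sup>2 / P $ i $ i))"
    by (auto simp: inner_vec_def Sigma_star_mult u_def power2_eq_square distrib_left intro!: sum.cong)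
  also have "\<dots> = (\<Sum>i\<in>UNIV. S $ i0 $ i * v $ i) * (u / S $ i0 $ i0)
      + (\<Sum>i\<in>UNIV. if i = i0 then 0 else (v $ i)\<^sup>2 / P $ i $ i)"
    by (simp add: sum.distrib sum_distrib_left sum_distrib_right sum_divide_distrib mult_ac)
  finally have eq: "v \<bullet> (Sigma_star i0 S *v v) =
      u\<^sup>2 / S $ i0 $ i0 + (\<Sum>i\<in>UNIV. if i = i0 then 0 else (v $ i)\<^sup>2 / P $ i $ i)"
    unfolding u_def[symmetric] by (simp add: power2_eq_square)
  have nn: "0 \<le> (if i = i0 then 0 else (v $ i)\<^sup>2 / P $ i $ i)" for i
    using inv_diag_pos[of i] by simp
  show "0 < v \<bullet> (Sigma_star i0 S *v v)"
  \<comment> \<open>The diagonal part is positive unless all noncentral entries vanish; then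
    \<open>u\<close> is a nonzero multiple of the centre entry and the rank-one part is
    positive.\<close>
  proof (cases "\<exists>i. i \<noteq> i0 \<and> v $ i \<noteq> 0")
    case True
    then obtain i where i: "i \<noteq> i0" "v $ i \<noteq> 0" by blast
    have "0 < (\<Sum>i\<in>UNIV. if i = i0 then 0 else (v $ i)\<^sup>2 / P $ i $ i)"
      using i inv_diag_pos[of i] nn by (intro sum_pos2[of _ i]) auto
    then show ?thesis
      using diag_pos[of i0] by (simp add: eq add_nonneg_pos)
  next
    case False
    then have "v $ i0 \<noteq> 0"
      using v by (metis vec_eq_iff zero_index)
    moreover have "u = S $ i0 $ i0 * v $ i0"
      unfolding u_def using False by (subst sum.remove[of _ i0]) (auto intro!: sum.neutral)
    ultimately show ?thesis
      using diag_pos[of i0] sum_nonneg[of UNIV "\<lambda>i. if i = i0 then 0 else (v $ i)\<^sup>2 / P $ i $ i", OF nn] by (simp add: eq add_pos_nonneg)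
  qed
qed

text \<open>\<open>Sigma_star i0 S = L D L\<^sup>T\<close> with \<open>D\<close> diagonal and \<open>L\<close> the identity except for its column \<open>i0\<close>.\<close>
lemma det_Sigma_star:
  "det (Sigma_star i0 S) = (\<Prod>i\<in>UNIV. if i = i0 then S $ i0 $ i0 else 1 / P $ i $ i)"
proof -
  \<comment> \<open>The column is written as a matrix-vector product to match
    \<open>cramer_lemma\<close>, which gives \<open>det L\<close> as entry \<open>i0\<close> of the
    inserted vector, that is 1.\<close>
  define L :: "real^'n^'n" where
    "L = (\<chi> i j. if j = i0 then (mat 1 *v (\<chi> k. S $ i0 $ k / S $ i0 $ i0)) $ i else mat 1 $ i $ j)"
  define D :: "real^'n^'n" where
    "D = (\<chi> i j. if i = j then if i = i0 then S $ i0 $ i0 else 1 / P $ i $ i else 0)"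
  have s: "S $ i0 $ i0 \<noteq> 0"
    using diag_pos[of i0] by simp
  have detL: "det L = 1"
    unfolding L_def using s by (subst cramer_lemma) (simp add: det_I)
  have L: "L $ i $ j = (if j = i0 then S $ i0 $ i / S $ i0 $ i0 else if i = j then 1 else 0)" for i j
    unfolding L_def matrix_vector_mul_lid by (simp add: mat_def)
  have Lt: "(transpose L *v v) $ i = (if i = i0 then (\<Sum>j\<in>UNIV. S $ i0 $ j * v $ j) / S $ i0 $ i0 else v $ i)" for v i
    by (simp add: matrix_vector_mult_def transpose_def L if_distrib[of "\<lambda>x. x * _"] sum_divide_distrib
        cong: if_cong)
  have Dm: "(D *v v) $ i = (if i = i0 then S $ i0 $ i0 else 1 / P $ i $ i) * v $ i" for v i
    by (simp add: matrix_vector_mult_def D_def if_distrib[of "\<lambda>x. x * _"] cong: if_cong)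
  have Lm: "(L *v v) $ i = S $ i0 $ i / S $ i0 $ i0 * v $ i0 + (if i = i0 then 0 else v $ i)" for v i
  proof -
    have "L $ i $ j * v $ j = (if j = i0 then S $ i0 $ i / S $ i0 $ i0 * v $ i0 else 0)
      + (if j = i then if i = i0 then 0 else v $ i else 0)" for j
      by (auto simp: L)
    then show ?thesis
      by (simp add: matrix_vector_mult_def sum.distrib)
  qed
  have "Sigma_star i0 S *v v = (L ** D ** transpose L) *v v" for v
    using s by (simp add: vec_eq_iff matrix_vector_mul_assoc[symmetric] Sigma_star_mult Lm Dm Lt
        del: transpose_matrix_vector)
  then have "Sigma_star i0 S = L ** D ** transpose L"
    by (simp add: matrix_eq)
  moreover have "det D = (\<Prod>i\<in>UNIV. D $ i $ i)"
    by (rule det_diagonal) (simp add: D_def)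
  ultimately show ?thesis
    by (simp add: det_mul det_transpose detL D_def)
qed

lemma inv_Sigma_star_form:
  assumes "w $ i0 = 0"
  shows "w \<bullet> (matrix_inv (Sigma_star i0 S) *v w) = (\<Sum>j\<in>UNIV - {i0}. P $ j $ j * (w $ j)\<^sup>2)"
proof -
  interpret star: spd "Sigma_star i0 S" by (rule spd_Sigma_star)
  \<comment> \<open>\<open>v\<close> is to solve \<open>Sigma_star i0 S *v v = w\<close>. The
    diagonal part dictates its noncentral entries; its centre entry makes the product with row
    \<open>i0\<close> zero, which switches off the rank-one part.\<close>
  define r where "r = (\<Sum>j\<in>UNIV - {i0}. S $ i0 $ j * (P $ j $ j * w $ j))"
  define v :: "real^'n" where "v = (\<chi> j. if j = i0 then - r / S $ i0 $ i0 else P $ j $ j * w $ j)"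
  have s: "S $ i0 $ i0 \<noteq> 0"
    using diag_pos[of i0] by simp
  have "(\<Sum>j\<in>UNIV. S $ i0 $ j * v $ j) = S $ i0 $ i0 * v $ i0 + (\<Sum>j\<in>UNIV - {i0}. S $ i0 $ j * v $ j)"
    by (rule sum.remove) auto
  also have "(\<Sum>j\<in>UNIV - {i0}. S $ i0 $ j * v $ j) = r"
    unfolding r_def by (intro sum.cong) (auto simp: v_def)
  also have "S $ i0 $ i0 * v $ i0 + r = 0"
    using s by (simp add: v_def)
  finally have "Sigma_star i0 S *v v = w"
    using assms inv_diag_pos by (auto simp: vec_eq_iff Sigma_star_mult v_def less_imp_neq[symmetric])
  then have "matrix_inv (Sigma_star i0 S) *v w = v"
    using star.mult_inv_vec(2) by metis
  moreover have "w \<bullet> v = w $ i0 * v $ i0 + (\<Sum>j\<in>UNIV - {i0}. w $ j * v $ j)"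
    unfolding inner_vec_def by (subst sum.remove[of _ i0]) auto
  ultimately show ?thesis
    using assms by (auto simp: v_def power2_eq_square intro!: sum.cong)
qed

section \<open>Conditional residuals and star-shaped Gaussian densities\<close>

text \<open>Conditional mean of coordinate \<open>j\<close> given that coordinate \<open>i0\<close> equals \<open>t\<close>, under \<open>\<N>(m, S)\<close>.\<close>
definition cond_mean :: "real^'n \<Rightarrow> 'n \<Rightarrow> 'n \<Rightarrow> real \<Rightarrow> real" where
  "cond_mean m i0 j t = m $ j + S $ i0 $ j / S $ i0 $ i0 * (t - m $ i0)"

lemma measurable_cond_mean [measurable]: "cond_mean m i0 j \<in> borel_measurable borel"
  unfolding cond_mean_def[abs_def] by simp

definition cond_resid :: "real^'n \<Rightarrow> 'n \<Rightarrow> real^'n \<Rightarrow> real^'n" where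
  "cond_resid m i0 z = (\<chi> j. if j = i0 then 0 else z $ j - cond_mean m i0 j (z $ i0))"

lemma mult_axis: "(S *v axis j 1) $ i = S $ j $ i"
  unfolding matrix_vector_mult_basis column_def by (simp add: entry_sym[of i j])

lemma cond_resid_eq:
  "cond_resid m i0 z = (z - m) - ((z - m) $ i0 / S $ i0 $ i0) *\<^sub>R (S *v axis i0 1)"
  using diag_pos[of i0]
  by (auto simp: vec_eq_iff cond_resid_def cond_mean_def mult_axis)

lemma inv_form_cond_resid:
  "(z - m) \<bullet> (P *v (z - m)) = (z $ i0 - m $ i0)\<^sup>2 / S $ i0 $ i0
    + cond_resid m i0 z \<bullet> (P *v cond_resid m i0 z)"
  using inv_form_split[of "z - m" i0] by (simp add: cond_resid_eq)

text \<open>\<open>S\<close> and \<open>Sigma_star i0 S\<close> share row and column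
  \<open>i0\<close>, hence have the same Schur splitting and the same residual. On the residual,
  \<open>P\<close> is replaced by its diagonal.\<close>

lemma inv_Sigma_star_form_cond_resid:
  "(z - m) \<bullet> (matrix_inv (Sigma_star i0 S) *v (z - m)) = (z $ i0 - m $ i0)\<^sup>2 / S $ i0 $ i0
    + (\<Sum>j\<in>UNIV - {i0}. P $ j $ j * (z $ j - cond_mean m i0 j (z $ i0))\<^sup>2)"
proof -
  interpret star: spd "Sigma_star i0 S" by (rule spd_Sigma_star)
  have row: "Sigma_star i0 S $ i0 $ j = S $ i0 $ j" "Sigma_star i0 S $ j $ i0 = S $ i0 $ j" for j
    by (auto simp: Sigma_star_def)
  have "Sigma_star i0 S *v axis i0 1 = S *v axis i0 1"
    by (simp add: vec_eq_iff star.mult_axis mult_axis row)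
  then have "(z - m) \<bullet> (star.P *v (z - m)) = (z $ i0 - m $ i0)\<^sup>2 / S $ i0 $ i0
      + cond_resid m i0 z \<bullet> (star.P *v cond_resid m i0 z)"
    using star.inv_form_split[of "z - m" i0] by (simp add: row cond_resid_eq)
  also have "cond_resid m i0 z \<bullet> (star.P *v cond_resid m i0 z)
      = (\<Sum>j\<in>UNIV - {i0}. P $ j $ j * (z $ j - cond_mean m i0 j (z $ i0))\<^sup>2)"
    by (subst inv_Sigma_star_form) (auto simp: cond_resid_def intro!: sum.cong)
  finally show ?thesis .
qed

text \<open>The kernel means of \<mu> as \<open>a\<close> give the density of \<nu>;
  \<open>cond_mean m i0\<close> gives that of the minimizer.\<close>

definition star_density :: "real^'n \<Rightarrow> 'n \<Rightarrow> ('n \<Rightarrow> real \<Rightarrow> real) \<Rightarrow> real^'n \<Rightarrow> real" where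
  "star_density m i0 a z = normal_density (m $ i0) (sqrt (S $ i0 $ i0)) (z $ i0) *
    (\<Prod>j\<in>UNIV - {i0}. normal_density (a j (z $ i0)) (sqrt (1 / P $ j $ j)) (z $ j))"

text \<open>The variances do not depend on \<open>a\<close> and multiply to
  \<open>det (Sigma_star i0 S)\<close>, so the whole family shares the normalising constant of the
  minimizer.\<close>

lemma star_density_eq:
  "star_density m i0 a z = exp (- (z $ i0 - m $ i0)\<^sup>2 / S $ i0 $ i0 / 2
      - (\<Sum>j\<in>UNIV - {i0}. P $ j $ j * (z $ j - a j (z $ i0))\<^sup>2) / 2)
    / sqrt ((2 * pi) ^ CARD('n) * det (Sigma_star i0 S))"
proof -
  let ?d = "\<lambda>i. if i = i0 then S $ i0 $ i0 else 1 / P $ i $ i"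
  have "sqrt ((2 * pi) ^ CARD('n) * det (Sigma_star i0 S)) = sqrt (\<Prod>i\<in>UNIV. 2 * pi * ?d i)"
    by (simp add: det_Sigma_star prod.distrib)
  also have "\<dots> = (\<Prod>i\<in>UNIV. sqrt (2 * pi * ?d i))"
    by (rule sqrt_prod)
  also have "\<dots> = sqrt (2 * pi * S $ i0 $ i0) * (\<Prod>i\<in>UNIV - {i0}. sqrt (2 * pi * (1 / P $ i $ i)))"
    by (subst prod.remove[of _ i0]) (auto intro!: prod.cong)
  finally have norm: "sqrt ((2 * pi) ^ CARD('n) * det (Sigma_star i0 S)) =
      sqrt (2 * pi * S $ i0 $ i0) * (\<Prod>i\<in>UNIV - {i0}. sqrt (2 * pi * (1 / P $ i $ i)))" .
  have "exp (- (z $ i0 - m $ i0)\<^sup>2 / S $ i0 $ i0 / 2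
      - (\<Sum>j\<in>UNIV - {i0}. P $ j $ j * (z $ j - a j (z $ i0))\<^sup>2) / 2)
      = exp (- (z $ i0 - m $ i0)\<^sup>2 / S $ i0 $ i0 / 2
      + (\<Sum>j\<in>UNIV - {i0}. - (P $ j $ j * (z $ j - a j (z $ i0))\<^sup>2) / 2))"
    by (simp add: sum_negf sum_divide_distrib)
  also have "\<dots> = exp (- (z $ i0 - m $ i0)\<^sup>2 / S $ i0 $ i0 / 2) *
      (\<Prod>j\<in>UNIV - {i0}. exp (- (P $ j $ j * (z $ j - a j (z $ i0))\<^sup>2) / 2))"
    unfolding exp_add by (subst exp_sum) auto
  finally have ex: "exp (- (z $ i0 - m $ i0)\<^sup>2 / S $ i0 $ i0 / 2
      - (\<Sum>j\<in>UNIV - {i0}. P $ j $ j * (z $ j - a j (z $ i0))\<^sup>2) / 2) = \<dots>" .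
  have sq: "(sqrt (S $ i0 $ i0))\<^sup>2 = S $ i0 $ i0" "(sqrt (1 / P $ j $ j))\<^sup>2 = 1 / P $ j $ j" for j
    using diag_pos[of i0] inv_diag_pos[of j] by (auto intro!: real_sqrt_pow2 less_imp_le)
  show ?thesis
    unfolding norm ex star_density_def normal_density_def sq prod_dividef prod.distrib
    by (simp add: mult_ac)
qed

lemma gauss_density_Sigma_star:
  "gauss_density m (Sigma_star i0 S) z = star_density m i0 (cond_mean m i0) z"
  by (simp add: gauss_density_def star_density_eq inv_Sigma_star_form_cond_resid diff_divide_distrib add_divide_distrib)

text \<open>Half the logarithm of \<open>det S / det (Sigma_star i0 S)\<close>, which turns out to
  be the minimal divergence.\<close>

definition log_const :: "'n \<Rightarrow> real" where
  "log_const i0 = ln (sqrt ((2 * pi) ^ CARD('n) * det S) / sqrt ((2 * pi) ^ CARD('n) * det (Sigma_star i0 S)))"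

text \<open>Logarithm of the star-shaped density relative to \<pi>; the equal centre marginals leave
  no separate centre term.\<close>

definition log_ratio :: "real^'n \<Rightarrow> 'n \<Rightarrow> ('n \<Rightarrow> real \<Rightarrow> real) \<Rightarrow> real^'n \<Rightarrow> real" where
  "log_ratio m i0 a z = log_const i0 + (cond_resid m i0 z \<bullet> (P *v cond_resid m i0 z)
    - (\<Sum>j\<in>UNIV - {i0}. P $ j $ j * (z $ j - a j (z $ i0))\<^sup>2)) / 2"

lemma star_density_ratio:
  "star_density m i0 a z = exp (log_ratio m i0 a z) * gauss_density m S z"
proof -
  interpret star: spd "Sigma_star i0 S" by (rule spd_Sigma_star)
  let ?c = "sqrt ((2 * pi) ^ CARD('n) * det S)" and ?d = "sqrt ((2 * pi) ^ CARD('n) * det (Sigma_star i0 S))"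
  have pos: "?c > 0" "?d > 0"
    using det_pos star.det_pos by auto
  have c: "exp (log_const i0) = ?c / ?d"
    unfolding log_const_def using pos by (intro exp_ln divide_pos_pos)
  have "exp (log_ratio m i0 a z) * gauss_density m S z = exp (log_const i0) / ?c *
    (exp ((cond_resid m i0 z \<bullet> (P *v cond_resid m i0 z)
    - (\<Sum>j\<in>UNIV - {i0}. P $ j $ j * (z $ j - a j (z $ i0))\<^sup>2)) / 2) * exp (- ((z - m) \<bullet> (P *v (z - m))) / 2))"
    by (simp add: log_ratio_def exp_add gauss_density_def)
  also have "\<dots> = 1 / ?d * exp (- (z $ i0 - m $ i0)\<^sup>2 / S $ i0 $ i0 / 2
      - (\<Sum>j\<in>UNIV - {i0}. P $ j $ j * (z $ j - a j (z $ i0))\<^sup>2) / 2)"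
    unfolding c inv_form_cond_resid[of z m i0] mult_exp_exp using less_imp_neq[OF pos(1)]
    by (simp add: diff_divide_distrib add_divide_distrib del: real_sqrt_eq_0_iff)
  finally show ?thesis
    by (simp add: star_density_eq)
qed

text \<open>Used twice: the whole space as rectangle shows that \<nu> has mass 1, and
  \<open>a = cond_mean m i0\<close> yields the disintegration of the minimizer.\<close>

lemma nn_integral_star_density_rect:
  assumes [measurable]: "\<And>j. a j \<in> borel_measurable borel" and A: "\<And>i. A i \<in> sets borel"
  shows "(\<integral>\<^sup>+z. ennreal (star_density m i0 a z) * indicator {z. \<forall>i. z $ i \<in> A i} z \<partial>lborel) =
    (\<integral>\<^sup>+t. indicator (A i0) t * (\<Prod>j\<in>UNIV - {i0}. emeasure (normal1 (a j t) (1 / P $ j $ j)) (A j))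
      \<partial>normal1 (m $ i0) (S $ i0 $ i0))"
proof -
  note [measurable] = A
  let ?G = "\<lambda>t. ennreal (normal_density (m $ i0) (sqrt (S $ i0 $ i0)) t) * indicator (A i0) t"
  let ?H = "\<lambda>j t x. ennreal (normal_density (a j t) (sqrt (1 / P $ j $ j)) x) * indicator (A j) x"
  have H: "(\<lambda>(t, x). ?H j t x) \<in> borel_measurable (borel \<Otimes>\<^sub>M borel)" for j
    unfolding normal_density_def by measurable
  have e: "emeasure (normal1 (a j t) (1 / P $ j $ j)) (A j) = (\<integral>\<^sup>+x. ?H j t x \<partial>lborel)" for j t
    by (simp add: normal1_def emeasure_density)
  have "(\<Prod>j\<in>UNIV. indicator (A j) (z $ j) :: ennreal) = indicator {z. \<forall>i. z $ i \<in> A i} z" for z :: "real^'n"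
    by (auto simp: indicator_def prod_zero_iff)
  then have ind: "indicator {z. \<forall>i. z $ i \<in> A i} z
      = indicator (A i0) (z $ i0) * (\<Prod>j\<in>UNIV - {i0}. indicator (A j) (z $ j) :: ennreal)" for z :: "real^'n"
    by (subst prod.remove[of UNIV i0, symmetric]) auto
  have "ennreal (star_density m i0 a z) * indicator {z. \<forall>i. z $ i \<in> A i} z
      = ?G (z $ i0) * (\<Prod>j\<in>UNIV - {i0}. ?H j (z $ i0) (z $ j))" for z
    by (simp add: star_density_def ennreal_mult prod_nonneg prod_ennreal[symmetric] prod.distrib mult_ac ind)
  then have "(\<integral>\<^sup>+z. ennreal (star_density m i0 a z) * indicator {z. \<forall>i. z $ i \<in> A i} z \<partial>lborel) =
      (\<integral>\<^sup>+z. ?G (z $ i0) * (\<Prod>j\<in>UNIV - {i0}. ?H j (z $ i0) (z $ j)) \<partial>lborel)"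
    by simp
  also have "\<dots> = (\<integral>\<^sup>+t. ?G t * (\<Prod>j\<in>UNIV - {i0}. \<integral>\<^sup>+x. ?H j t x \<partial>lborel) \<partial>lborel)"
    by (rule nn_integral_lborel_star[OF _ H]) measurable
  also have "\<dots> = (\<integral>\<^sup>+t. indicator (A i0) t * (\<Prod>j\<in>UNIV - {i0}. emeasure (normal1 (a j t) (1 / P $ j $ j)) (A j))
      \<partial>normal1 (m $ i0) (S $ i0 $ i0))"
  proof -
    have "(\<lambda>t. \<integral>\<^sup>+x. ?H j t x \<partial>lborel) \<in> borel_measurable borel" for j
      using H[of j] by measurable
    then have "(\<lambda>t. indicator (A i0) t * (\<Prod>j\<in>UNIV - {i0}. \<integral>\<^sup>+x. ?H j t x \<partial>lborel)) \<in> borel_measurable lborel"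
      by measurable
    then show ?thesis
      unfolding e unfolding normal1_def by (subst nn_integral_density) (auto simp: mult_ac)
  qed
  finally show ?thesis .
qed

end

section \<open>Relative entropy\<close>

text \<open>Divided by \<open>x\<close>, the expression is s - 1 - ln s at s = y/x, which is
  nonnegative and vanishes only at 1. For \<open>x = 0\<close> it equals
  \<open>y > 0\<close>.\<close>

lemma entropy_integrand_nonneg:
  fixes x y :: real
  assumes "0 \<le> x" "0 < y"
  shows "0 \<le> x * ln x - x * ln y - x + y"
    and "x * ln x - x * ln y - x + y = 0 \<Longrightarrow> x = y"
proof -
  have *: "0 \<le> x * ln x - x * ln y - x + y \<and> (x * ln x - x * ln y - x + y = 0 \<longrightarrow> x = y)"
  proof (cases "x = 0")
    case False
    then have x: "0 < x" using assms by simp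
    have eq: "x * ln x - x * ln y - x + y = x * ((y / x - 1) - ln (y / x))"
      using x assms by (simp add: ln_div field_simps)
    have "ln (y / x) \<le> y / x - 1"
      using x assms by (intro ln_le_minus_one) simp
    moreover have "y / x = 1" if "ln (y / x) = y / x - 1"
      using that x assms by (intro ln_eq_minus_one) auto
    ultimately show ?thesis
      unfolding eq using x by auto
  qed (use assms in auto)
  then show "0 \<le> x * ln x - x * ln y - x + y" "x * ln x - x * ln y - x + y = 0 \<Longrightarrow> x = y"
    by auto
qed

text \<open>Convex duality between entropy and exponential: the preceding inequality with
  \<open>exp y\<close> in place of \<open>y\<close>.\<close>

lemma young_exp:
  fixes x y :: real
  assumes "0 \<le> x"
  shows "x * y \<le> \<bar>x * ln x\<bar> + exp y"
  using entropy_integrand_nonneg(1)[OF assms, of "exp y"] assms by simp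

text \<open>Adding \<open>h - f\<close>, whose integral is 0, makes the integrand nonnegative
  pointwise, so the equality case can be read off pointwise too.\<close>

lemma gibbs_inequality:
  fixes f h :: "'a \<Rightarrow> real"
  assumes f: "f \<in> borel_measurable M" "\<And>x. 0 \<le> f x" "(\<integral>\<^sup>+x. ennreal (f x) \<partial>M) = 1"
    and h: "h \<in> borel_measurable M" "\<And>x. 0 < h x" "(\<integral>\<^sup>+x. ennreal (h x) \<partial>M) = 1"
    and int: "integrable M (\<lambda>x. f x * ln (f x))" "integrable M (\<lambda>x. f x * ln (h x))"
  shows "(\<integral>x. f x * ln (h x) \<partial>M) \<le> (\<integral>x. f x * ln (f x) \<partial>M)"
    and "(\<integral>x. f x * ln (h x) \<partial>M) = (\<integral>x. f x * ln (f x) \<partial>M) \<Longrightarrow> AE x in M. f x = h x"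
proof -
  let ?D = "\<lambda>x. f x * ln (f x) - f x * ln (h x) - f x + h x"
  have fh: "integrable M f" "integrable M h" "(\<integral>x. f x \<partial>M) = 1" "(\<integral>x. h x \<partial>M) = 1"
    using f h nn_integral_eq_integrable[where f=f and M=M and x=1] nn_integral_eq_integrable[where f=h and M=M and x=1]
    by (auto intro: less_imp_le)
  have D: "integrable M ?D"
    using int fh by auto
  have ID: "(\<integral>x. ?D x \<partial>M) = (\<integral>x. f x * ln (f x) \<partial>M) - (\<integral>x. f x * ln (h x) \<partial>M)"
    using int fh by simp
  have nn: "0 \<le> ?D x" for x
    using f(2)[of x] h(2)[of x] by (rule entropy_integrand_nonneg)
  show "(\<integral>x. f x * ln (h x) \<partial>M) \<le> (\<integral>x. f x * ln (f x) \<partial>M)"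
    using integral_nonneg_AE[of ?D M] nn ID by auto
  assume "(\<integral>x. f x * ln (h x) \<partial>M) = (\<integral>x. f x * ln (f x) \<partial>M)"
  then have "AE x in M. ?D x = 0"
    using integral_nonneg_eq_0_iff_AE[OF D] nn ID by auto
  then show "AE x in M. f x = h x"
    by eventually_elim (rule entropy_integrand_nonneg(2)[OF f(2) h(2)])
qed

text \<open>The entropy estimates need a real density. The derivative of a probability measure is
  finite almost everywhere, so \<open>enn2real\<close> alters it on a null set only.\<close>

lemma (in sigma_finite_measure) KL_div_finiteE:
  assumes KL: "KL_div \<mu> M \<noteq> \<infinity>" and \<mu>: "prob_space \<mu>" "sets \<mu> = sets M"
  obtains f :: "'a \<Rightarrow> real" where "f \<in> borel_measurable M" "\<And>x. 0 \<le> f x"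
    "\<mu> = density M (\<lambda>x. ennreal (f x))" "integrable \<mu> (\<lambda>x. ln (f x))"
    "KL_div \<mu> M = ereal (\<integral>x. ln (f x) \<partial>\<mu>)"
proof
  let ?f = "\<lambda>x. enn2real (RN_deriv M \<mu> x)"
  have ac: "absolutely_continuous M \<mu>" and int: "integrable \<mu> (\<lambda>x. ln (?f x))"
    and eq: "KL_div \<mu> M = ereal (\<integral>x. ln (?f x) \<partial>\<mu>)"
    using KL by (auto simp: KL_div_def split: if_splits)
  show "?f \<in> borel_measurable M" by simp
  have "AE x in M. RN_deriv M \<mu> x \<noteq> \<infinity>"
    by (rule RN_deriv_finite[OF prob_space_imp_sigma_finite[OF \<mu>(1)] ac \<mu>(2)])
  then have "density M (\<lambda>x. ennreal (?f x)) = density M (RN_deriv M \<mu>)"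
    by (intro density_cong) (auto simp: less_top)
  also have "\<dots> = \<mu>"
    by (rule density_RN_deriv[OF ac \<mu>(2)])
  finally show "\<mu> = density M (\<lambda>x. ennreal (?f x))" ..
qed (use KL in \<open>auto simp: KL_div_def split: if_splits\<close>)

lemma (in sigma_finite_measure) KL_div_density:
  fixes f :: "'a \<Rightarrow> real"
  assumes f: "f \<in> borel_measurable M" "\<And>x. 0 \<le> f x"
    and int: "integrable (density M (\<lambda>x. ennreal (f x))) (\<lambda>x. ln (f x))"
  shows "KL_div (density M (\<lambda>x. ennreal (f x))) M
    = ereal (\<integral>x. ln (f x) \<partial>density M (\<lambda>x. ennreal (f x)))"
proof -
  let ?\<mu> = "density M (\<lambda>x. ennreal (f x))"
  have fm: "(\<lambda>x. ennreal (f x)) \<in> borel_measurable M" using f by simp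
  have ac: "absolutely_continuous M ?\<mu>"
    by (rule absolutely_continuousI_density[OF fm])
  have "AE x in M. ennreal (f x) = RN_deriv M ?\<mu> x"
    by (rule RN_deriv_unique[OF fm refl])
  then have "AE x in M. ln (enn2real (RN_deriv M ?\<mu> x)) = ln (f x)"
    by eventually_elim (metis enn2real_ennreal f(2))
  then have AE: "AE x in ?\<mu>. ln (enn2real (RN_deriv M ?\<mu> x)) = ln (f x)"
    unfolding AE_density[OF fm] by (rule eventually_mono) simp
  have m: "(\<lambda>x. ln (enn2real (RN_deriv M ?\<mu> x))) \<in> borel_measurable ?\<mu>" "(\<lambda>x. ln (f x)) \<in> borel_measurable ?\<mu>"
    using f by auto
  have "integrable ?\<mu> (\<lambda>x. ln (enn2real (RN_deriv M ?\<mu> x)))"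
    using integrable_cong_AE[OF m AE] int by simp
  moreover have "(\<integral>x. ln (enn2real (RN_deriv M ?\<mu> x)) \<partial>?\<mu>) = (\<integral>x. ln (f x) \<partial>?\<mu>)"
    by (rule integral_cong_AE[OF m AE])
  ultimately show ?thesis
    using ac by (simp add: KL_div_def)
qed

section \<open>Normal kernels and second moments\<close>

lemma prob_space_normal1: "0 < v \<Longrightarrow> prob_space (normal1 a v)"
  unfolding normal1_def by (rule prob_space_normal_density) simp

lemma sets_normal1 [simp]: "sets (normal1 a v) = sets borel"
  by (simp add: normal1_def)

lemma measurable_normal1:
  fixes a :: "real \<Rightarrow> real"
  assumes [measurable]: "a \<in> borel_measurable borel" and v: "0 < v"
  shows "(\<lambda>t. normal1 (a t) v) \<in> borel \<rightarrow>\<^sub>M prob_algebra borel"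
proof (rule measurable_prob_algebraI)
  show "prob_space (normal1 (a t) v)" for t :: real
    using v by (rule prob_space_normal1)
  show "(\<lambda>t. normal1 (a t) v) \<in> borel \<rightarrow>\<^sub>M subprob_algebra borel"
  proof (rule measurable_subprob_algebra)
    show "subprob_space (normal1 (a t) v)" for t
      using prob_space_normal1[OF v] by (rule prob_space_imp_subprob_space)
    fix A :: "real set" assume [measurable]: "A \<in> sets borel"
    have "emeasure (normal1 (a t) v) A = (\<integral>\<^sup>+x. ennreal (normal_density (a t) (sqrt v) x) * indicator A x \<partial>lborel)" for t
      by (simp add: normal1_def emeasure_density)
    moreover have "(\<lambda>t. \<integral>\<^sup>+x. ennreal (normal_density (a t) (sqrt v) x) * indicator A x \<partial>lborel) \<in> borel_measurable borel"
      unfolding normal_density_def by measurable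
    ultimately show "(\<lambda>t. emeasure (normal1 (a t) v) A) \<in> borel_measurable borel"
      by simp
  qed simp
qed

lemma integral_normal1: "0 < v \<Longrightarrow> (\<integral>x. x \<partial>normal1 a v) = a"
  unfolding normal1_def using normal_moment_nz_1[of "sqrt v" a]
  by (subst integral_density) (auto simp: has_bochner_integral_iff)

text \<open>The hypothesis has the form that \<open>young_exp\<close> delivers. Constants are square
  integrable for a finite measure, so the centring at \<open>m\<close> can be undone.\<close>

lemma square_integrable_coordinate:
  fixes m :: "real^'n::finite"
  assumes "finite_measure \<mu>" and sets: "sets \<mu> = sets borel" and \<epsilon>: "0 < \<epsilon>"
    and fin: "(\<integral>\<^sup>+z. ennreal (\<epsilon> * ((z - m) \<bullet> (z - m))) \<partial>\<mu>) < \<infinity>"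
  shows "integrable \<mu> (\<lambda>z. (z $ j)\<^sup>2)"
proof -
  interpret finite_measure \<mu> by fact
  have meas: "f \<in> \<mu> \<rightarrow>\<^sub>M N \<longleftrightarrow> f \<in> borel \<rightarrow>\<^sub>M N" for f :: "real^'n \<Rightarrow> real" and N
    by (simp add: sets cong: measurable_cong_sets)
  have "integrable \<mu> (\<lambda>z. \<epsilon> * ((z - m) \<bullet> (z - m)))"
    using fin \<epsilon> by (intro integrableI_nonneg) (auto simp: meas)
  then have "integrable \<mu> (\<lambda>z. (z - m) \<bullet> (z - m))"
    using \<epsilon> by simp
  then have "integrable \<mu> (\<lambda>z. (z $ j - m $ j)\<^sup>2)"
  proof (rule Bochner_Integration.integrable_bound)
    show "AE z in \<mu>. norm ((z $ j - m $ j)\<^sup>2) \<le> norm ((z - m) \<bullet> (z - m))"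
    proof (intro AE_I2)
      fix z :: "real^'n"
      have "(z $ j - m $ j)\<^sup>2 \<le> (\<Sum>i\<in>UNIV. (z $ i - m $ i)\<^sup>2)"
        by (intro member_le_sum) auto
      then show "norm ((z $ j - m $ j)\<^sup>2) \<le> norm ((z - m) \<bullet> (z - m))"
        by (simp add: inner_vec_def power2_eq_square)
    qed
  qed (simp add: meas)
  then have "integrable \<mu> (\<lambda>z. ((z $ j - m $ j) + m $ j)\<^sup>2)"
    by (intro integrable_square_add) (auto simp: meas)
  then show ?thesis by simp
qed

text \<open>Needed for the covariance \<open>Sigma_star i0 S\<close>, since the minimizer is itself
  fed into \<open>expectation_log_ratio\<close>.\<close>

lemma (in spd) gaussian_square_integrable: "integrable (gaussian m S) (\<lambda>z. (z $ j)\<^sup>2)"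
proof -
  obtain \<epsilon> where \<epsilon>: "\<epsilon> > 0" "(\<integral>\<^sup>+z. ennreal (exp (\<epsilon> * ((z - m) \<bullet> (z - m)))) \<partial>gaussian m S) < \<infinity>"
    using gaussian_exp_moment by blast
  have "(\<integral>\<^sup>+z. ennreal (\<epsilon> * ((z - m) \<bullet> (z - m))) \<partial>gaussian m S)
      \<le> (\<integral>\<^sup>+z. ennreal (exp (\<epsilon> * ((z - m) \<bullet> (z - m)))) \<partial>gaussian m S)"
    by (intro nn_integral_mono ennreal_leI order.trans[OF _ exp_ge_add_one_self]) simp
  then show ?thesis
    using \<epsilon> by (intro square_integrable_coordinate[OF finite_measure_gaussian, where \<epsilon>=\<epsilon> and m=m]) auto
qed

section \<open>The expected log-density ratio\<close>

context spd
begin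

lemma measurable_log_ratio [measurable]:
  assumes [measurable]: "\<And>j. a j \<in> borel_measurable borel"
  shows "log_ratio m i0 a \<in> borel_measurable borel"
proof -
  have "continuous_on UNIV (cond_resid m i0)"
    unfolding cond_resid_eq[abs_def] using diag_pos[of i0] by (intro continuous_intros) simp
  then have "continuous_on UNIV (\<lambda>z. cond_resid m i0 z \<bullet> (P *v cond_resid m i0 z))"
    by (intro continuous_intros matrix_vector_mult_linear_continuous_on
        continuous_on_compose2[of UNIV "\<lambda>w. P *v w" UNIV "cond_resid m i0"]) auto
  then have [measurable]: "(\<lambda>z. cond_resid m i0 z \<bullet> (P *v cond_resid m i0 z)) \<in> borel_measurable borel"
    by (rule borel_measurable_continuous_onI)
  show ?thesis
    unfolding log_ratio_def[abs_def] by measurable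
qed

end

locale gaussian_star = spd S + star_measure i0 \<mu> p K
  for S :: "real^'n^'n::finite" and i0 :: 'n and \<mu> :: "(real^'n) measure" and p K +
  fixes m :: "real^'n"
begin

text \<open>The b(t) of the overview, with entry 0 at the centre.\<close>

definition mean_dev :: "real \<Rightarrow> real^'n" where
  "mean_dev t = (\<chi> j. if j = i0 then 0 else mean j t - cond_mean m i0 j t)"

lemma expectation_log_ratio:
  assumes L2: "\<And>j. integrable \<mu> (\<lambda>z. (z $ j)\<^sup>2)"
  shows "integrable \<mu> (log_ratio m i0 mean)"
    and "integrable \<mu> (\<lambda>z. mean_dev (z $ i0) \<bullet> (P *v mean_dev (z $ i0)))"
    and "(\<integral>z. log_ratio m i0 mean z \<partial>\<mu>) =
      log_const i0 + (\<integral>z. mean_dev (z $ i0) \<bullet> (P *v mean_dev (z $ i0)) \<partial>\<mu>) / 2"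
proof -
  have meas: "(\<lambda>t. mean_dev t $ j) \<in> borel_measurable borel" for j
    by (cases "j = i0") (simp_all add: mean_dev_def)
  have cm: "integrable \<mu> (\<lambda>z. (cond_mean m i0 j (z $ i0))\<^sup>2)" for j
  proof -
    have "integrable \<mu> (\<lambda>z. (S $ i0 $ j / S $ i0 $ i0 * z $ i0)\<^sup>2)"
      using L2[of i0] by (simp add: power_mult_distrib power_divide)
    then have "integrable \<mu> (\<lambda>z. (S $ i0 $ j / S $ i0 $ i0 * z $ i0
        + (m $ j - S $ i0 $ j / S $ i0 $ i0 * m $ i0))\<^sup>2)"
      by (intro integrable_square_add) auto
    then show ?thesis
      by (simp add: cond_mean_def algebra_simps diff_divide_distrib)
  qed
  have dev2: "integrable \<mu> (\<lambda>z. (mean_dev (z $ i0) $ j)\<^sup>2)" for j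
  proof (cases "j = i0")
    case False
    have "integrable \<mu> (\<lambda>z. (mean j (z $ i0) - cond_mean m i0 j (z $ i0))\<^sup>2)"
      by (intro integrable_square_diff integrable_mean_square[OF L2 False] cm) auto
    then show ?thesis using False by (simp add: mean_dev_def)
  qed (simp add: mean_dev_def)
  \<comment> \<open>The residual for \<pi> is the residual for \<mu> plus a function of the centre,
    as \<open>quadratic_form_integral\<close> requires.\<close>
  have w: "cond_resid m i0 z = resid z + mean_dev (z $ i0)" for z
    by (simp add: vec_eq_iff cond_resid_def resid_def mean_dev_def)
  have "(\<Sum>j\<in>UNIV. P $ j $ j * (resid z $ j)\<^sup>2) = (\<Sum>j\<in>UNIV - {i0}. P $ j $ j * (z $ j - mean j (z $ i0))\<^sup>2)" for z
    by (subst sum.remove[of UNIV i0]) (auto simp: resid_def intro!: sum.cong)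
  then have eq: "log_ratio m i0 mean z = log_const i0 +
      ((resid z + mean_dev (z $ i0)) \<bullet> (P *v (resid z + mean_dev (z $ i0))) - (\<Sum>j\<in>UNIV. P $ j $ j * (resid z $ j)\<^sup>2)) / 2" for z
    by (simp add: log_ratio_def w)
  note q = quadratic_form_integral[OF L2 meas dev2, of P]
  show "integrable \<mu> (\<lambda>z. mean_dev (z $ i0) \<bullet> (P *v mean_dev (z $ i0)))"
    by (rule q(2))
  show "integrable \<mu> (log_ratio m i0 mean)"
    unfolding eq[abs_def] using q(1) by (intro Bochner_Integration.integrable_add integrable_const integrable_divide)
  show "(\<integral>z. log_ratio m i0 mean z \<partial>\<mu>) =
      log_const i0 + (\<integral>z. mean_dev (z $ i0) \<bullet> (P *v mean_dev (z $ i0)) \<partial>\<mu>) / 2"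
    unfolding eq using q(1) prob_space[simplified]
    by (subst Bochner_Integration.integral_add) (auto simp: q(3))
qed

end

section \<open>The minimizer and the lower bound\<close>

context spd
begin

lemma star_measure_gaussian_Sigma_star:
  "star_measure i0 (gaussian m (Sigma_star i0 S)) (normal1 (m $ i0) (S $ i0 $ i0))
    (\<lambda>j t. normal1 (cond_mean m i0 j t) (1 / P $ j $ j))"
proof -
  interpret star: spd "Sigma_star i0 S" by (rule spd_Sigma_star)
  let ?\<pi>s = "gaussian m (Sigma_star i0 S)" and ?p = "normal1 (m $ i0) (S $ i0 $ i0)"
  let ?K = "\<lambda>j t. normal1 (cond_mean m i0 j t) (1 / P $ j $ j)"
  have rect: "emeasure ?\<pi>s {z. \<forall>i. z $ i \<in> A i} =
      (\<integral>\<^sup>+t. indicator (A i0) t * (\<Prod>j\<in>UNIV - {i0}. emeasure (?K j t) (A j)) \<partial>?p)"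
    if A: "\<And>i. A i \<in> sets borel" for A
  proof -
    have "emeasure ?\<pi>s {z. \<forall>i. z $ i \<in> A i} =
        (\<integral>\<^sup>+z. ennreal (gauss_density m (Sigma_star i0 S) z) * indicator {z. \<forall>i. z $ i \<in> A i} z \<partial>lborel)"
      unfolding gaussian_def using sets_rectangle[OF A] by (subst emeasure_density) auto
    then show ?thesis
      using nn_integral_star_density_rect[OF measurable_cond_mean A, of m i0] gauss_density_Sigma_star
      by simp
  qed
  have p: "prob_space ?p"
    by (rule prob_space_normal1[OF diag_pos])
  have K: "prob_space (?K j t)" for j t
    by (rule prob_space_normal1) (simp add: inv_diag_pos)
  show ?thesis
  proof (rule star_measure.intro)
    \<comment> \<open>The whole space is a rectangle, so the total mass reduces to that of
      one-dimensional normal laws.\<close>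
    have "emeasure ?\<pi>s UNIV = emeasure ?p UNIV"
      using rect[of "\<lambda>_. UNIV"] prob_space.emeasure_space_1[OF K]
      by (simp add: normal1_def)
    then show "prob_space ?\<pi>s"
      using prob_space.emeasure_space_1[OF p] by (intro prob_spaceI) (simp add: normal1_def)
    show "?p \<in> space (prob_algebra borel)"
      using p by (simp add: space_prob_algebra)
    show "?K j \<in> borel \<rightarrow>\<^sub>M prob_algebra borel" for j
      by (rule measurable_normal1) (simp_all add: inv_diag_pos)
  qed (use rect in simp_all)
qed

lemma gaussian_Sigma_star_eq_density:
  "gaussian m (Sigma_star i0 S) =
    density (gaussian m S) (\<lambda>z. ennreal (exp (log_ratio m i0 (cond_mean m i0) z)))"
  unfolding gaussian_def gauss_density_Sigma_star star_density_ratio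
  by (subst density_density_eq)
    (auto simp: ennreal_mult less_imp_le[OF gauss_density_pos] mult.commute)

text \<open>The minimizer has the conditional means of \<pi>, so \<open>mean_dev\<close> vanishes
  and only the constant of the log ratio remains.\<close>

lemma KL_div_gaussian_Sigma_star:
  "KL_div (gaussian m (Sigma_star i0 S)) (gaussian m S) = ereal (log_const i0)"
proof -
  interpret star: spd "Sigma_star i0 S" by (rule spd_Sigma_star)
  let ?\<pi>s = "gaussian m (Sigma_star i0 S)"
  interpret G: gaussian_star S i0 ?\<pi>s "normal1 (m $ i0) (S $ i0 $ i0)"
      "\<lambda>j t. normal1 (cond_mean m i0 j t) (1 / P $ j $ j)" m
    by (intro gaussian_star.intro spd_axioms star_measure_gaussian_Sigma_star)
  interpret \<pi>: finite_measure "gaussian m S" by (rule finite_measure_gaussian)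
  have mean: "G.mean = cond_mean m i0"
    by (intro ext) (simp add: G.mean_def integral_normal1 inv_diag_pos)
  have dev: "G.mean_dev t = 0" for t
    by (simp add: G.mean_dev_def mean vec_eq_iff)
  note E = G.expectation_log_ratio[OF star.gaussian_square_integrable, unfolded mean dev]
  have "KL_div ?\<pi>s (gaussian m S) = ereal (\<integral>z. log_ratio m i0 (cond_mean m i0) z \<partial>?\<pi>s)"
    using \<pi>.KL_div_density[of "\<lambda>z. exp (log_ratio m i0 (cond_mean m i0) z)"] E(1)
    unfolding gaussian_Sigma_star_eq_density by (simp cong: measurable_cong_sets)
  then show ?thesis
    using E(3) by simp
qed

text \<open>Gibbs is applied to the densities \<open>f\<close> of \<mu> and \<open>h\<close> of
  \<nu> relative to \<pi>. The integral of \<open>f * ln h\<close> is the constant plus half the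
  expected form of \<open>mean_dev\<close>, which is nonnegative.\<close>

lemma KL_div_star_class:
  assumes \<mu>: "\<mu> \<in> star_class i0"
  shows "ereal (log_const i0) \<le> KL_div \<mu> (gaussian m S)"
    and "KL_div \<mu> (gaussian m S) = ereal (log_const i0) \<Longrightarrow> \<mu> = gaussian m (Sigma_star i0 S)"
proof -
  let ?\<pi> = "gaussian m S"
  have "ereal (log_const i0) \<le> KL_div \<mu> ?\<pi> \<and>
    (KL_div \<mu> ?\<pi> = ereal (log_const i0) \<longrightarrow> \<mu> = gaussian m (Sigma_star i0 S))"
  proof (cases "KL_div \<mu> ?\<pi> = \<infinity>")
    case False
    obtain p K where "star_measure i0 \<mu> p K"
      using \<mu> unfolding star_class_def star_measure_def by blast
    then interpret G: gaussian_star S i0 \<mu> p K m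
      by (rule gaussian_star.intro[OF spd_axioms])
    interpret \<pi>: finite_measure ?\<pi> by (rule finite_measure_gaussian)
    have meas_\<pi>: "g \<in> ?\<pi> \<rightarrow>\<^sub>M N \<longleftrightarrow> g \<in> borel \<rightarrow>\<^sub>M N" for g :: "real^'n \<Rightarrow> 'z" and N
      by (simp cong: measurable_cong_sets)
    obtain f where f: "f \<in> borel_measurable ?\<pi>" "\<And>x. 0 \<le> f x"
        and \<mu>_eq: "\<mu> = density ?\<pi> (\<lambda>x. ennreal (f x))"
        and int_f: "integrable \<mu> (\<lambda>x. ln (f x))"
        and KL: "KL_div \<mu> ?\<pi> = ereal (\<integral>x. ln (f x) \<partial>\<mu>)"
      using \<pi>.KL_div_finiteE[OF False G.prob_\<mu>] G.sets_\<mu> by auto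
    have integrable_\<mu>: "integrable \<mu> g \<longleftrightarrow> integrable ?\<pi> (\<lambda>x. f x * g x)"
      and integral_\<mu>: "(\<integral>x. g x \<partial>\<mu>) = (\<integral>x. f x * g x \<partial>?\<pi>)"
      if "g \<in> borel_measurable borel" for g :: "real^'n \<Rightarrow> real"
      using that f by (simp_all add: \<mu>_eq integrable_density integral_density meas_\<pi>)
    have [measurable]: "f \<in> borel_measurable borel"
      using f(1) by (simp add: meas_\<pi>)
    have L2: "integrable \<mu> (\<lambda>z. (z $ j)\<^sup>2)" for j
    proof -
      obtain \<epsilon> where \<epsilon>: "\<epsilon> > 0" "(\<integral>\<^sup>+z. ennreal (exp (\<epsilon> * ((z - m) \<bullet> (z - m)))) \<partial>?\<pi>) < \<infinity>"
        using gaussian_exp_moment by blast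
      have "(\<integral>\<^sup>+z. ennreal (\<epsilon> * ((z - m) \<bullet> (z - m))) \<partial>\<mu>)
          = (\<integral>\<^sup>+z. ennreal (f z) * ennreal (\<epsilon> * ((z - m) \<bullet> (z - m))) \<partial>?\<pi>)"
        using f unfolding \<mu>_eq by (subst nn_integral_density) (auto simp: meas_\<pi>)
      also have "\<dots> \<le> (\<integral>\<^sup>+z. ennreal \<bar>f z * ln (f z)\<bar> + ennreal (exp (\<epsilon> * ((z - m) \<bullet> (z - m)))) \<partial>?\<pi>)"
      proof (intro nn_integral_mono)
        fix z
        have "f z * (\<epsilon> * ((z - m) \<bullet> (z - m))) \<le> \<bar>f z * ln (f z)\<bar> + exp (\<epsilon> * ((z - m) \<bullet> (z - m)))"
          using f(2) by (rule young_exp)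
        then show "ennreal (f z) * ennreal (\<epsilon> * ((z - m) \<bullet> (z - m)))
            \<le> ennreal \<bar>f z * ln (f z)\<bar> + ennreal (exp (\<epsilon> * ((z - m) \<bullet> (z - m))))"
          using f(2) \<epsilon>(1) by (simp add: ennreal_mult[symmetric] ennreal_plus[symmetric] ennreal_leI
              del: ennreal_plus)
      qed
      also have "\<dots> = (\<integral>\<^sup>+z. ennreal \<bar>f z * ln (f z)\<bar> \<partial>?\<pi>)
          + (\<integral>\<^sup>+z. ennreal (exp (\<epsilon> * ((z - m) \<bullet> (z - m)))) \<partial>?\<pi>)"
        by (intro nn_integral_add) (auto simp: meas_\<pi>)
      also have "\<dots> < \<infinity>"
      proof -
        have "integrable ?\<pi> (\<lambda>z. f z * ln (f z))"
          using int_f by (subst integrable_\<mu>[symmetric]) auto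
        then have "(\<integral>\<^sup>+z. ennreal \<bar>f z * ln (f z)\<bar> \<partial>?\<pi>) < \<infinity>"
          by (simp add: integrable_iff_bounded)
        with \<epsilon>(2) show ?thesis by simp
      qed
      finally show ?thesis
        by (rule square_integrable_coordinate[OF G.finite_measure_axioms G.sets_\<mu> \<epsilon>(1)])
    qed
    define h where "h z = exp (log_ratio m i0 G.mean z)" for z
    have [measurable]: "h \<in> borel_measurable borel"
      unfolding h_def by simp
    note E = G.expectation_log_ratio[OF L2]
    have h1: "(\<integral>\<^sup>+z. ennreal (h z) \<partial>?\<pi>) = 1"
    proof -
      have "(\<integral>\<^sup>+z. ennreal (h z) \<partial>?\<pi>) = (\<integral>\<^sup>+z. ennreal (star_density m i0 G.mean z) \<partial>lborel)"
        unfolding gaussian_def h_def star_density_ratio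
        by (subst nn_integral_density)
          (auto simp: ennreal_mult less_imp_le[OF gauss_density_pos] mult.commute)
      also have "\<dots> = emeasure (normal1 (m $ i0) (S $ i0 $ i0)) UNIV"
        using nn_integral_star_density_rect[of G.mean "\<lambda>_. UNIV" m i0]
          prob_space.emeasure_space_1[OF prob_space_normal1, of "1 / P $ _ $ _"] inv_diag_pos
        by (simp add: normal1_def)
      also have "\<dots> = 1"
        using prob_space.emeasure_space_1[OF prob_space_normal1[OF diag_pos]] by (simp add: normal1_def)
      finally show ?thesis .
    qed
    have f1: "(\<integral>\<^sup>+z. ennreal (f z) \<partial>?\<pi>) = 1"
    proof -
      have "(\<integral>\<^sup>+z. ennreal (f z) \<partial>?\<pi>) = emeasure \<mu> (space \<mu>)"
        unfolding \<mu>_eq using f(1) by (simp add: emeasure_density)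
      then show ?thesis
        by (simp only: G.emeasure_space_1)
    qed
    have ln_h: "ln (h z) = log_ratio m i0 G.mean z" for z
      by (simp add: h_def)
    have int: "integrable ?\<pi> (\<lambda>z. f z * ln (f z))" "integrable ?\<pi> (\<lambda>z. f z * ln (h z))"
      using int_f E(1) unfolding ln_h by (simp_all add: integrable_\<mu>)
    have KL': "KL_div \<mu> ?\<pi> = ereal (\<integral>z. f z * ln (f z) \<partial>?\<pi>)"
      unfolding KL by (subst integral_\<mu>) auto
    let ?q = "\<lambda>z. G.mean_dev (z $ i0) \<bullet> (P *v G.mean_dev (z $ i0))"
    have Eh: "(\<integral>z. f z * ln (h z) \<partial>?\<pi>) = log_const i0 + (\<integral>z. ?q z \<partial>\<mu>) / 2"
      unfolding ln_h using E(3) by (subst integral_\<mu>[symmetric]) auto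
    have q_nonneg: "0 \<le> ?q z" for z
      using inv_pos[of "G.mean_dev (z $ i0)"] by (cases "G.mean_dev (z $ i0) = 0") auto
    then have Eq: "0 \<le> (\<integral>z. ?q z \<partial>\<mu>)"
      by (intro integral_nonneg_AE) auto
    have gibbs: "(\<integral>z. f z * ln (h z) \<partial>?\<pi>) \<le> (\<integral>z. f z * ln (f z) \<partial>?\<pi>)"
        "(\<integral>z. f z * ln (h z) \<partial>?\<pi>) = (\<integral>z. f z * ln (f z) \<partial>?\<pi>) \<Longrightarrow> AE z in ?\<pi>. f z = h z"
      using gibbs_inequality[OF f f1 _ _ h1 int] by (auto simp: meas_\<pi> h_def[abs_def])
    have "\<mu> = gaussian m (Sigma_star i0 S)" if eq: "KL_div \<mu> ?\<pi> = ereal (log_const i0)"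
    proof -
      have q0: "(\<integral>z. ?q z \<partial>\<mu>) = 0" and fh: "AE z in ?\<pi>. f z = h z"
        using eq gibbs Eq unfolding KL' Eh by auto
      \<comment> \<open>This holds only \<mu>-almost everywhere, but \<open>f = h > 0\<close>
        \<pi>-almost everywhere carries it over to \<pi>. There kernel means and conditional means
        agree, and \<open>h\<close> is the density of the minimizer.\<close>
      have "AE z in \<mu>. ?q z = 0"
        using integral_nonneg_eq_0_iff_AE[OF E(2)] q_nonneg q0 by auto
      then have "AE z in ?\<pi>. 0 < f z \<longrightarrow> ?q z = 0"
        using f(1) unfolding \<mu>_eq by (subst (asm) AE_density) auto
      then have "AE z in ?\<pi>. ennreal (f z) = ennreal (exp (log_ratio m i0 (cond_mean m i0) z))"
        using fh
      proof eventually_elim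
        case (elim z)
        then have "?q z = 0"
          by (simp add: h_def)
        then have dev: "G.mean_dev (z $ i0) = 0"
          using inv_pos[of "G.mean_dev (z $ i0)"] by force
        have "G.mean j (z $ i0) = cond_mean m i0 j (z $ i0)" if "j \<noteq> i0" for j
          using arg_cong[OF dev, of "\<lambda>v. v $ j"] that by (simp add: G.mean_dev_def)
        then have "log_ratio m i0 G.mean z = log_ratio m i0 (cond_mean m i0) z"
          by (simp add: log_ratio_def)
        then show ?case
          using elim by (simp add: h_def)
      qed
      then show ?thesis
        unfolding \<mu>_eq gaussian_Sigma_star_eq_density
        by (intro density_cong) (auto simp: meas_\<pi>)
    qed
    then show ?thesis
      using gibbs(1) Eq unfolding KL' Eh by auto
  \<comment> \<open>An infinite divergence exceeds the real constant, which also voids the equality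
    case.\<close>
  qed simp
  then show "ereal (log_const i0) \<le> KL_div \<mu> ?\<pi>"
    "KL_div \<mu> ?\<pi> = ereal (log_const i0) \<Longrightarrow> \<mu> = gaussian m (Sigma_star i0 S)"
    by auto
qed

end

theorem mainTheorem7:
  fixes m :: "real^'n::finite" and S :: "real^'n^'n" and i0 :: 'n
  assumes "CARD('n) \<ge> 2"
    and "transpose S = S"
    and "\<forall>x. x \<noteq> 0 \<longrightarrow> 0 < x \<bullet> (S *v x)"
  shows "let \<pi> = gaussian m S; \<pi>s = gaussian m (Sigma_star i0 S) in
    \<pi>s \<in> star_class i0 \<and>
    (\<forall>\<mu>\<in>star_class i0. KL_div \<pi>s \<pi> \<le> KL_div \<mu> \<pi>) \<and>
    (\<forall>\<mu>\<in>star_class i0. KL_div \<mu> \<pi> = KL_div \<pi>s \<pi> \<longrightarrow> \<mu> = \<pi>s) \<and>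
    (\<forall>A. (\<forall>i. A i \<in> sets borel) \<longrightarrow>
       emeasure \<pi>s {z. \<forall>i. z $ i \<in> A i} =
       (\<integral>\<^sup>+ t. indicator (A i0) t *
           (\<Prod>j\<in>UNIV - {i0}. emeasure
              (normal1 (m $ j + S $ i0 $ j / S $ i0 $ i0 * (t - m $ i0))
                       (1 / matrix_inv S $ j $ j)) (A j))
         \<partial>normal1 (m $ i0) (S $ i0 $ i0)))"
proof -
  interpret spd S
    by (rule spd.intro[OF assms(2)]) (use assms(3) in blast)
  interpret star: star_measure i0 "gaussian m (Sigma_star i0 S)" "normal1 (m $ i0) (S $ i0 $ i0)"
      "\<lambda>j t. normal1 (cond_mean m i0 j t) (1 / P $ j $ j)"
    by (rule star_measure_gaussian_Sigma_star)
  have "gaussian m (Sigma_star i0 S) \<in> star_class i0"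
    unfolding star_class_def
    by (intro CollectI conjI exI[of _ "normal1 (m $ i0) (S $ i0 $ i0)"]
        exI[of _ "\<lambda>j t. normal1 (cond_mean m i0 j t) (1 / P $ j $ j)"] allI impI
        star.prob_\<mu> star.sets_\<mu> star.p_prob star.K_meas star.rect) simp
  then show ?thesis
    \<comment> \<open>With the divergence of the candidate replaced by the constant, minimality and
      uniqueness are the two halves of \<open>KL_div_star_class\<close>.\<close>
    unfolding Let_def KL_div_gaussian_Sigma_star
    using KL_div_star_class[of _ i0 m] star.rect[unfolded cond_mean_def] by blast
qed

end
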